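(* For every $q\in[1,2]$ and every $\varepsilon\in(0,1)$ there is a constant $c(q,\varepsilon)>0$, depending only on $q$ and $\varepsilon$, such that the following holds. Let $s,b\in\mathbb N$, $N=sb$, and let $\Phi$ and $\Psi$ be symmetric norms on $\mathbb R^s$ and $\mathbb R^b$, respectively. Let $B\subset\mathbb R^N$ be the unit ball of the mixed norm $$\|x\|:=\Psi\big(\Phi(x[1]),\dots,\Phi(x[b])\big),\qquad x\in\mathbb R^N .$$ Then for every integer $n\ge 0$ with $n\le N(1-\varepsilon)$, $$d_n(B,\ell_q^N)\ \ge\ c(q,\varepsilon)\sup_{x\in B}\|x\|_q\ =\ c(q,\varepsilon)\sup_{\Phi(y)\le 1}\|y\|_q\ \sup_{\Psi(z)\le 1}\|z\|_q ,$$ where $y$ ranges over $\mathbb R^s$ and $z$ over $\mathbb R^b$.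
   Context: The coordinates of $\mathbb R^N$, $N=sb$, are split into $b$ blocks of size $s$: for $x\in\mathbb R^N$ and $1\le j\le b$, $x[j]:=(x_i)_{s(j-1)<i\le sj}\in\mathbb R^s$. A norm on $\mathbb R^m$ is symmetric if its unit ball is invariant under arbitrary changes of signs of coordinates and arbitrary permutations of coordinates. On $\mathbb R^m$, $\|x\|_q=(\sum_k|x_k|^q)^{1/q}$, and $\ell_q^N$ is $\mathbb R^N$ with this norm. The Kolmogorov width of a subset $K$ of a normed space $X$ is $d_n(K,X)=\inf_{Q_n}\sup_{x\in K}\inf_{y\in Q_n}\|x-y\|_X$, the outer infimum over all linear subspaces $Q_n\subset X$ of dimension at most $n$. *)

theory Defs
  imports "HOL-Analysis.Analysis" "HOL-Library.Function_Algebras"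
begin

text \<open>
  The dimensions are universally quantified inside the scope of the constant, so they cannot be
  types.  The space of real \<open>m\<close>-vectors is the subspace \<open>coord_space m\<close> of \<open>nat \<Rightarrow> real\<close>
  (with pointwise operations) of functions vanishing outside \<open>{..<m}\<close>; coordinates are
  counted from \<open>0\<close>.
\<close>

instantiation "fun" :: (type, real_vector) real_vector
begin

definition "scaleR a f = (\<lambda>x. a *\<^sub>R f x)"

instance
  by standard (simp_all add: scaleR_fun_def fun_eq_iff scaleR_add_right scaleR_add_left)

end

definition coord_space :: "nat \<Rightarrow> (nat \<Rightarrow> real) set" where
  "coord_space m = {x. \<forall>i\<ge>m. x i = 0}"

text \<open>Functions defined on the ambient type are used as norms on a subspace \<open>V\<close> only;
  their values outside \<open>V\<close> are irrelevant.\<close>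

definition norm_on :: "'a::real_vector set \<Rightarrow> ('a \<Rightarrow> real) \<Rightarrow> bool" where
  "norm_on V p \<longleftrightarrow>
     (\<forall>x\<in>V. 0 \<le> p x \<and> (p x = 0 \<longleftrightarrow> x = 0)) \<and>
     (\<forall>x\<in>V. \<forall>a. p (a *\<^sub>R x) = \<bar>a\<bar> * p x) \<and>
     (\<forall>x\<in>V. \<forall>y\<in>V. p (x + y) \<le> p x + p y)"

definition unit_ball :: "'a set \<Rightarrow> ('a \<Rightarrow> real) \<Rightarrow> 'a set" where
  "unit_ball V p = {x \<in> V. p x \<le> 1}"

definition symmetric_norm :: "nat \<Rightarrow> ((nat \<Rightarrow> real) \<Rightarrow> real) \<Rightarrow> bool" where
  "symmetric_norm m p \<longleftrightarrow>
     norm_on (coord_space m) p \<and>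
     (\<forall>\<sigma>. (\<forall>i. \<sigma> i \<in> {-1, 1}) \<longrightarrow>
        (\<lambda>x i. \<sigma> i * x i) ` unit_ball (coord_space m) p = unit_ball (coord_space m) p) \<and>
     (\<forall>\<pi>. \<pi> permutes {..<m} \<longrightarrow>
        (\<lambda>x. x \<circ> \<pi>) ` unit_ball (coord_space m) p = unit_ball (coord_space m) p)"

definition lq_norm :: "real \<Rightarrow> nat \<Rightarrow> (nat \<Rightarrow> real) \<Rightarrow> real" where
  "lq_norm q m x = (\<Sum>k<m. \<bar>x k\<bar> powr q) powr (1 / q)"

definition block :: "nat \<Rightarrow> (nat \<Rightarrow> real) \<Rightarrow> nat \<Rightarrow> (nat \<Rightarrow> real)" where
  "block s x j = (\<lambda>i. if i < s then x (s * j + i) else 0)"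

definition mixed_norm ::
  "nat \<Rightarrow> nat \<Rightarrow> ((nat \<Rightarrow> real) \<Rightarrow> real) \<Rightarrow> ((nat \<Rightarrow> real) \<Rightarrow> real) \<Rightarrow> (nat \<Rightarrow> real) \<Rightarrow> real" where
  "mixed_norm s b \<Phi> \<Psi> x = \<Psi> (\<lambda>j. if j < b then \<Phi> (block s x j) else 0)"

text \<open>The explicit finiteness condition excludes infinite-dimensional subspaces, for which
  \<^const>\<open>dim\<close> is \<open>0\<close>.  Suprema and infima are taken in the extended reals, where
  they need no boundedness side conditions.\<close>

definition kolmogorov_width ::
  "nat \<Rightarrow> 'a::real_vector set \<Rightarrow> 'a set \<Rightarrow> ('a \<Rightarrow> real) \<Rightarrow> ereal" where
  "kolmogorov_width n K V p =
     (INF Q \<in> {Q. subspace Q \<and> Q \<subseteq> V \<and> (\<exists>S. finite S \<and> Q = span S) \<and> dim Q \<le> n}.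
        SUP x \<in> K. INF y \<in> Q. ereal (p (x - y)))"

end

theory Submission
  imports Defs
begin

text \<open>
  The lower bound is proved for tensor products.  Every \<open>x\<close> in the mixed ball \<open>B\<close> is dominated in
  \<open>q\<close>-norm by some \<open>w k = y (k mod s) * z (k div s)\<close> with \<open>y\<close> and \<open>z\<close> in the unit balls of \<open>\<Phi>\<close>
  and \<open>\<Psi>\<close> (\<open>lq_norm_le_tensor\<close>); such \<open>w\<close> lie in \<open>B\<close> and their \<open>q\<close>-norm factors, which also
  gives the product formula for the supremum (\<open>SUP_lq_norm_mixed_ball\<close>).  The ball is invariant under
  all sign changes and under a family of \<open>N\<close> permutations acting transitively on the coordinates, the
  cyclic shifts inside and of the blocks.  It remains to find, for a subspace \<open>Q\<close> of dimension at most
  \<open>(1 - \<epsilon>) N\<close>, a point of \<open>B\<close> whose distance to \<open>Q\<close> is at least a constant times the norm of \<open>w\<close>.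
  
  For \<open>1 < q\<close> such a point is found in the orbit of \<open>w\<close>.  Let \<open>P\<close> be the orthogonal projection onto
  the complement of \<open>Q\<close>, and let \<open>x\<close> be the vector of the conjugate space \<open>l\<^sub>p\<close> that norms \<open>w\<close>.
  Averaged over the signed shifts \<open>g\<close>, the inner product of \<open>g w\<close> with \<open>P (g x)\<close> is the trace of
  \<open>P\<close> divided by \<open>N\<close>, at least \<open>\<epsilon>\<close>, times the inner product of \<open>w\<close> with \<open>x\<close>
  (\<open>sum_signed_shift_trace\<close>).  Since \<open>2 \<le> p\<close>, Khinchine's inequality shows that the average of
  the \<open>p\<close>-th power of the \<open>p\<close>-norm of \<open>P (g x)\<close> is bounded by a constant times that of \<open>x\<close>
  (\<open>sum_signed_shift_moment_le\<close>).  In the inner product \<open>g w\<close> may be replaced by \<open>g w - v\<close> for any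
  \<open>v\<close> in \<open>Q\<close>, so these differences cannot all be small in \<open>q\<close>-norm (\<open>orbit_far_from_kernel\<close>).
  
  The constant in Khinchine's inequality degenerates as \<open>p\<close> tends to infinity, and \<open>q = 1\<close> needs
  another argument.  There, averaging \<open>\<bar>y\<bar>\<close> and \<open>\<bar>z\<bar>\<close> over shifts makes \<open>w\<close> a constant
  vector of the same \<open>l\<^sub>1\<close> norm, so that \<open>B\<close> contains multiples of all sign vectors.  A vertex of the
  section of the cube by the complement of \<open>Q\<close> has at least \<open>\<epsilon> N\<close> coordinates of modulus one and
  certifies that the sign vector with its signs is at \<open>l\<^sub>1\<close> distance at least \<open>\<epsilon> N\<close> from \<open>Q\<close>
  (\<open>cube_section_vertex\<close>, \<open>sign_vector_far_from_span\<close>).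
\<close>

section \<open>Moments of Rademacher sums\<close>

definition flip :: "nat set \<Rightarrow> nat \<Rightarrow> real" where
  "flip A i = (if i \<in> A then -1 else 1)"

lemma flip_mult_self [simp]: "flip A i * flip A i = 1"
  by (simp add: flip_def)

text \<open>
  For \<open>y \<ge> 0\<close> the logarithm of \<open>cosh y\<close> has derivative \<open>tanh y \<le> y\<close>; integrate.
\<close>

lemma cosh_le_exp_half_square: "cosh x \<le> exp (x\<^sup>2 / 2)" for x :: real
proof -
  have tanh_le: "tanh y \<le> y" if "0 \<le> y" for y :: real
  proof -
    have "0 - tanh 0 \<le> y - tanh y"
      by (rule DERIV_nonneg_imp_nondecreasing[OF that])
         (rule exI conjI derivative_eq_intros refl | simp)+
    then show ?thesis by simp
  qed
  have pos: "cosh y \<le> exp (y\<^sup>2 / 2)" if "0 \<le> y" for y :: real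
  proof -
    have "0\<^sup>2 / 2 - ln (cosh 0) \<le> y\<^sup>2 / 2 - ln (cosh y)"
    proof (rule DERIV_nonneg_imp_nondecreasing[OF that])
      fix u :: real assume "0 \<le> u" "u \<le> y"
      have "((\<lambda>u. u\<^sup>2 / 2 - ln (cosh u)) has_real_derivative u - tanh u) (at u)"
        by (auto intro!: derivative_eq_intros simp: tanh_def)
      then show "\<exists>D. ((\<lambda>u. u\<^sup>2 / 2 - ln (cosh u)) has_real_derivative D) (at u) \<and> 0 \<le> D"
        using tanh_le[OF \<open>0 \<le> u\<close>] by (intro exI[of _ "u - tanh u"]) simp
    qed
    then have "ln (cosh y) \<le> y\<^sup>2 / 2" by simp
    then show ?thesis by (metis cosh_real_pos exp_le_cancel_iff exp_ln)
  qed
  show ?thesis using pos[of x] pos[of "- x"] by (cases "0 \<le> x") auto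
qed

text \<open>
  Up to the factor \<open>2 ^ card I\<close> the left side is the expectation of the exponential of a Rademacher
  sum; by independence it is a product of hyperbolic cosines.
\<close>

lemma sum_exp_flip_le:
  assumes "finite I"
  shows "(\<Sum>A\<in>Pow I. exp (\<Sum>i\<in>I. flip A i * a i)) \<le> 2 ^ card I * exp ((\<Sum>i\<in>I. (a i)\<^sup>2) / 2)"
proof -
  have "(\<Sum>A\<in>Pow I. exp (\<Sum>i\<in>I. flip A i * a i)) = (\<Prod>i\<in>I. exp (- a i) + exp (a i))"
    unfolding prod_add[OF assms]
  proof (rule sum.cong[OF refl])
    fix A assume "A \<in> Pow I"
    then have A: "A \<subseteq> I" by simp
    have "exp (\<Sum>i\<in>I. flip A i * a i) = (\<Prod>i\<in>I. exp (flip A i * a i))"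
      using assms by (simp add: exp_sum)
    also have "\<dots> = (\<Prod>i\<in>I-A. exp (flip A i * a i)) * (\<Prod>i\<in>A. exp (flip A i * a i))"
      by (rule prod.subset_diff[OF A assms])
    also have "\<dots> = (\<Prod>i\<in>A. exp (- a i)) * (\<Prod>i\<in>I - A. exp (a i))"
      by (subst mult.commute, intro arg_cong2[of _ _ _ _ "(*)"] prod.cong) (auto simp: flip_def)
    finally show "exp (\<Sum>i\<in>I. flip A i * a i) = (\<Prod>i\<in>A. exp (- a i)) * (\<Prod>i\<in>I - A. exp (a i))" .
  qed
  also have "\<dots> \<le> (\<Prod>i\<in>I. 2 * exp ((a i)\<^sup>2 / 2))"
  proof (rule prod_mono, intro conjI)
    fix i
    show "exp (- a i) + exp (a i) \<le> 2 * exp ((a i)\<^sup>2 / 2)"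
      using cosh_le_exp_half_square[of "a i"] by (simp add: cosh_field_def field_simps)
  qed (simp add: add_nonneg_nonneg)
  also have "\<dots> = 2 ^ card I * exp ((\<Sum>i\<in>I. (a i)\<^sup>2) / 2)"
    using assms by (simp add: prod.distrib exp_sum[symmetric] sum_divide_distrib)
  finally show ?thesis .
qed

lemma powr_le_exp:
  fixes p t :: real
  assumes "0 < p"
  shows "\<bar>t\<bar> powr p \<le> p powr p * (exp t + exp (- t))"
proof -
  have "\<bar>t\<bar> / p \<le> exp (\<bar>t\<bar> / p)"
    using exp_ge_add_one_self[of "\<bar>t\<bar> / p"] by linarith
  then have "(\<bar>t\<bar> / p) powr p \<le> exp (\<bar>t\<bar> / p) powr p"
    using assms by (intro powr_mono2) auto
  also have "\<dots> = exp \<bar>t\<bar>" using assms by (simp add: exp_powr_real)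
  also have "\<dots> \<le> exp t + exp (- t)" by (cases "0 \<le> t") auto
  finally have "\<bar>t\<bar> powr p / p powr p \<le> exp t + exp (- t)"
    using assms by (simp add: powr_divide)
  then show ?thesis using assms by (simp add: field_simps)
qed

definition khinchine_const :: "real \<Rightarrow> real" where
  "khinchine_const p = 2 * p powr p * exp (1 / 2)"

lemma khinchine_const_pos: "0 < p \<Longrightarrow> 0 < khinchine_const p"
  by (simp add: khinchine_const_def)

text \<open>
  Khinchine's inequality, in the direction that bounds moments by the variance.  After scaling the
  coefficients to variance one, the \<open>p\<close>-th power is dominated by \<open>exp t + exp (- t)\<close>, and the
  sub-Gaussian bound above is applied to both exponentials.
\<close>

lemma khinchine:
  fixes p :: real
  assumes "finite I" "0 < p"
  shows "(\<Sum>A\<in>Pow I. \<bar>\<Sum>i\<in>I. flip A i * a i\<bar> powr p)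
           \<le> 2 ^ card I * khinchine_const p * (\<Sum>i\<in>I. (a i)\<^sup>2) powr (p / 2)"
proof (cases "(\<Sum>i\<in>I. (a i)\<^sup>2) = 0")
  case True
  then have "\<forall>i\<in>I. a i = 0" using assms by (simp add: sum_nonneg_eq_0_iff)
  then show ?thesis using assms by simp
next
  case False
  define V where "V = (\<Sum>i\<in>I. (a i)\<^sup>2)"
  have V: "0 < V" using False unfolding V_def by (metis less_eq_real_def sum_nonneg zero_le_power2)
  define v where "v = sqrt V"
  have v: "0 < v" "v\<^sup>2 = V" using V by (auto simp: v_def)
  define d where "d i = a i / v" for i
  have "(\<Sum>i\<in>I. (d i)\<^sup>2) = 1"
    using V by (simp add: d_def power_divide v(2) sum_divide_distrib[symmetric] V_def[symmetric])
  then have e: "(\<Sum>A\<in>Pow I. exp (\<Sum>i\<in>I. flip A i * d i)) \<le> 2 ^ card I * exp (1 / 2)"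
    and e': "(\<Sum>A\<in>Pow I. exp (\<Sum>i\<in>I. flip A i * - d i)) \<le> 2 ^ card I * exp (1 / 2)"
    using sum_exp_flip_le[OF assms(1), of d] sum_exp_flip_le[OF assms(1), of "\<lambda>i. - d i"] by auto
  have "(\<Sum>A\<in>Pow I. \<bar>\<Sum>i\<in>I. flip A i * d i\<bar> powr p)
      \<le> (\<Sum>A\<in>Pow I. p powr p * (exp (\<Sum>i\<in>I. flip A i * d i) + exp (\<Sum>i\<in>I. flip A i * - d i)))"
    by (intro sum_mono order.trans[OF powr_le_exp[OF assms(2)]]) (simp add: sum_negf)
  also have "\<dots> = p powr p * ((\<Sum>A\<in>Pow I. exp (\<Sum>i\<in>I. flip A i * d i))
                + (\<Sum>A\<in>Pow I. exp (\<Sum>i\<in>I. flip A i * - d i)))"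
    by (simp only: sum_distrib_left[symmetric] sum.distrib)
  also have "\<dots> \<le> p powr p * (2 ^ card I * exp (1 / 2) + 2 ^ card I * exp (1 / 2))"
    by (intro mult_left_mono add_mono e e') simp
  finally have main: "(\<Sum>A\<in>Pow I. \<bar>\<Sum>i\<in>I. flip A i * d i\<bar> powr p) \<le> 2 ^ card I * khinchine_const p"
    by (simp add: khinchine_const_def algebra_simps)
  have vp: "v powr p = V powr (p / 2)"
    using v V by (metis powr_half_sqrt powr_powr mult.commute times_divide_eq_right mult_1_right v_def less_imp_le)
  have "(\<Sum>A\<in>Pow I. \<bar>\<Sum>i\<in>I. flip A i * a i\<bar> powr p)
      = (\<Sum>A\<in>Pow I. v powr p * \<bar>\<Sum>i\<in>I. flip A i * d i\<bar> powr p)"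
  proof (rule sum.cong[OF refl])
    fix A
    have "(\<Sum>i\<in>I. flip A i * a i) = v * (\<Sum>i\<in>I. flip A i * d i)"
      using v by (simp add: d_def sum_distrib_left)
    then show "\<bar>\<Sum>i\<in>I. flip A i * a i\<bar> powr p = v powr p * \<bar>\<Sum>i\<in>I. flip A i * d i\<bar> powr p"
      using v by (simp add: abs_mult powr_mult)
  qed
  also have "\<dots> = V powr (p / 2) * (\<Sum>A\<in>Pow I. \<bar>\<Sum>i\<in>I. flip A i * d i\<bar> powr p)"
    by (simp add: sum_distrib_left vp)
  also have "\<dots> \<le> V powr (p / 2) * (2 ^ card I * khinchine_const p)"
    by (intro mult_left_mono main) simp
  finally show ?thesis by (simp add: V_def algebra_simps)
qed

text \<open>
  Jensen's inequality for a sub-probability weight.  With \<open>m\<close> the weighted mean, write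
  \<open>m powr r\<close> as the weighted sum of \<open>u i * m powr (r - 1)\<close>, apply Young's inequality to each
  product, and absorb the resulting fraction of \<open>m powr r\<close> on the left.
\<close>

lemma jensen_powr:
  fixes r :: real
  assumes "1 \<le> r" "finite I" "\<And>i. i \<in> I \<Longrightarrow> 0 \<le> \<rho> i" "\<And>i. i \<in> I \<Longrightarrow> 0 \<le> u i"
    and le1: "(\<Sum>i\<in>I. \<rho> i) \<le> 1"
  shows "(\<Sum>i\<in>I. \<rho> i * u i) powr r \<le> (\<Sum>i\<in>I. \<rho> i * u i powr r)"
proof (cases "r = 1")
  case True
  have "0 \<le> (\<Sum>i\<in>I. \<rho> i * u i)" using assms by (intro sum_nonneg) auto
  then show ?thesis using True assms by (auto intro!: sum_mono)
next
  case False
  then have r: "1 < r" using assms by simp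
  define m where "m = (\<Sum>i\<in>I. \<rho> i * u i)"
  have m: "0 \<le> m" unfolding m_def using assms by (intro sum_nonneg) auto
  show ?thesis
  proof (cases "m = 0")
    case True
    then show ?thesis unfolding m_def[symmetric] using assms by (auto intro!: sum_nonneg)
  next
    case False
    then have m0: "0 < m" using m by simp
    define r' where "r' = r / (r - 1)"
    have r': "1 < r'" "1 / r + 1 / r' = 1" "(r - 1) * r' = r"
      using r by (auto simp: r'_def field_simps)
    have young: "u i * m powr (r - 1) \<le> u i powr r / r + m powr r / r'" if "i \<in> I" for i
      using Youngs_inequality[OF r r'(1,2), of "u i" "m powr (r - 1)"] assms(4)[OF that] r'(3)
      by (simp add: powr_powr)
    have "m powr r = m * m powr (r - 1)"
      using m0 by (simp add: powr_diff)
    also have "\<dots> = (\<Sum>i\<in>I. \<rho> i * (u i * m powr (r - 1)))"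
      by (subst (1) m_def) (simp add: sum_distrib_right mult.assoc)
    also have "\<dots> \<le> (\<Sum>i\<in>I. \<rho> i * (u i powr r / r + m powr r / r'))"
      by (intro sum_mono mult_left_mono young assms)
    also have "\<dots> = (\<Sum>i\<in>I. \<rho> i * u i powr r) / r + (\<Sum>i\<in>I. \<rho> i) * (m powr r / r')"
      by (simp add: distrib_left sum.distrib sum_divide_distrib sum_distrib_right)
    also have "\<dots> \<le> (\<Sum>i\<in>I. \<rho> i * u i powr r) / r + 1 * (m powr r / r')"
      using r' by (intro add_left_mono mult_right_mono le1) auto
    finally have "m powr r * (1 - 1 / r') \<le> (\<Sum>i\<in>I. \<rho> i * u i powr r) / r"
      by (simp add: algebra_simps)
    moreover have "1 - 1 / r' = 1 / r" using r'(2) by linarith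
    ultimately show ?thesis using r by (simp add: m_def field_simps)
  qed
qed

section \<open>Orthogonal projections as matrices\<close>

definition orth_proj :: "nat \<Rightarrow> (nat \<Rightarrow> nat \<Rightarrow> real) \<Rightarrow> bool" where
  "orth_proj N P \<longleftrightarrow> (\<forall>k l. P k l = P l k) \<and> (\<forall>k<N. \<forall>l<N. (\<Sum>j<N. P k j * P j l) = P k l)"

definition mat_app :: "nat \<Rightarrow> (nat \<Rightarrow> nat \<Rightarrow> real) \<Rightarrow> (nat \<Rightarrow> real) \<Rightarrow> nat \<Rightarrow> real" where
  "mat_app N P x k = (\<Sum>l<N. P k l * x l)"

text \<open>
  When \<open>P\<close> is the orthogonal projection onto the complement of a subspace \<open>Q\<close>, these are the vectors
  that agree with a vector of \<open>Q\<close> in the first \<open>N\<close> coordinates.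
\<close>

definition kills :: "nat \<Rightarrow> (nat \<Rightarrow> nat \<Rightarrow> real) \<Rightarrow> (nat \<Rightarrow> real) \<Rightarrow> bool" where
  "kills N P y \<longleftrightarrow> (\<forall>k<N. mat_app N P y k = 0)"

lemma inner_mat_app:
  assumes "orth_proj N P"
  shows "(\<Sum>k<N. y k * mat_app N P x k) = (\<Sum>k<N. mat_app N P y k * x k)"
proof -
  have "(\<Sum>k<N. y k * mat_app N P x k) = (\<Sum>k<N. \<Sum>l<N. P l k * y k * x l)"
    using assms by (simp add: mat_app_def sum_distrib_left orth_proj_def mult_ac)
  also have "\<dots> = (\<Sum>l<N. mat_app N P y l * x l)"
    by (subst sum.swap) (simp add: mat_app_def sum_distrib_right)
  finally show ?thesis .
qed

text \<open>
  Gram--Schmidt in matrix form: each new vector \<open>v\<close> costs the rank-one correction along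
  \<open>u = P v\<close>, which keeps \<open>P\<close> a projection, still kills the earlier vectors, and lowers the trace by
  one.  The trace bound replaces a statement about the rank of \<open>P\<close>.
\<close>

lemma orth_proj_exists:
  assumes "finite S"
  shows "\<exists>P. orth_proj N P \<and> (\<forall>y\<in>S. kills N P y) \<and> real N - real (card S) \<le> (\<Sum>k<N. P k k)"
  using assms
proof (induction S rule: finite_induct)
  case empty
  show ?case
    by (intro exI[of _ "\<lambda>k l. of_bool (k = l)"])
       (auto simp: orth_proj_def of_bool_def if_distrib[of "\<lambda>c. c * _"] cong: if_cong)
next
  case (insert v S)
  then obtain P where P: "orth_proj N P" "\<forall>y\<in>S. kills N P y"
    "real N - real (card S) \<le> (\<Sum>k<N. P k k)" by blast
  define u where "u = mat_app N P v"
  define U where "U = (\<Sum>k<N. (u k)\<^sup>2)"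
  show ?case
  proof (cases "U = 0")
    case True
    then have "kills N P v"
      unfolding kills_def u_def[symmetric] U_def by (simp add: sum_nonneg_eq_0_iff)
    with P insert show ?thesis by (intro exI[of _ P]) auto
  next
    case False
    have Pu: "(\<Sum>l<N. P k l * u l) = u k" if "k < N" for k
    proof -
      have "(\<Sum>l<N. P k l * u l) = (\<Sum>l<N. \<Sum>j<N. P k l * P l j * v j)"
        by (simp add: u_def mat_app_def sum_distrib_left mult.assoc)
      also have "\<dots> = (\<Sum>j<N. (\<Sum>l<N. P k l * P l j) * v j)"
        by (subst sum.swap) (simp add: sum_distrib_right)
      also have "\<dots> = u k"
        unfolding u_def mat_app_def using P(1) that
        by (intro sum.cong refl arg_cong2[of _ _ _ _ "(*)"]) (auto simp only: orth_proj_def lessThan_iff)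
      finally show ?thesis .
    qed
    have sym: "P k l = P l k" for k l using P(1) by (simp add: orth_proj_def)
    have uv: "(\<Sum>l<N. u l * v l) = U"
    proof -
      have "(\<Sum>l<N. v l * u l) = (\<Sum>l<N. v l * mat_app N P u l)"
        by (rule sum.cong) (auto simp: mat_app_def Pu)
      also have "\<dots> = (\<Sum>l<N. u l * u l)" by (subst inner_mat_app[OF P(1)]) (simp add: u_def)
      finally show ?thesis by (simp add: U_def power2_eq_square mult.commute)
    qed
    have uy: "(\<Sum>l<N. u l * y l) = 0" if "y \<in> S" for y
    proof -
      have "(\<Sum>l<N. y l * mat_app N P v l) = 0"
        using P(2) that by (subst inner_mat_app[OF P(1)]) (simp add: kills_def)
      then show ?thesis by (simp add: u_def mult.commute)
    qed
    define P' where "P' k l = P k l - u k * u l / U" for k l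
    have app: "mat_app N P' y k = mat_app N P y k - u k * (\<Sum>l<N. u l * y l) / U" for y k
      by (simp add: mat_app_def P'_def algebra_simps sum_subtractf sum_distrib_left
          sum_divide_distrib)
    have "(\<Sum>j<N. P' k j * P' j l) = P' k l" if "k < N" "l < N" for k l
    proof -
      have PP: "(\<Sum>j<N. P k j * P j l) = P k l" using P(1) that unfolding orth_proj_def by blast
      have "(\<Sum>j<N. P' k j * P' j l) = (\<Sum>j<N. P k j * P j l - (P k j * u j) * (u l / U)
          - (P l j * u j) * (u k / U) + (u j)\<^sup>2 * (u k * u l / U\<^sup>2))"
        by (rule sum.cong) (auto simp: P'_def algebra_simps power2_eq_square sym[of l])
      also have "\<dots> = P k l - u k * (u l / U) - u l * (u k / U) + U * (u k * u l / U\<^sup>2)"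
        using that
        by (simp only: sum.distrib sum_subtractf sum_distrib_right[symmetric] Pu U_def[symmetric] PP)
      also have "\<dots> = P' k l" using False by (simp add: P'_def power2_eq_square)
      finally show ?thesis .
    qed
    then have "orth_proj N P'" using sym by (simp add: orth_proj_def P'_def mult.commute)
    moreover have "kills N P' y" if "y \<in> insert v S" for y
      using that P(2) uv uy False by (auto simp: kills_def app u_def)
    moreover have "real N - real (card (insert v S)) \<le> (\<Sum>k<N. P' k k)"
    proof -
      have "(\<Sum>k<N. P' k k) = (\<Sum>k<N. P k k) - 1"
        using False
        by (simp add: P'_def sum_subtractf sum_divide_distrib[symmetric] power2_eq_square[symmetric]
            U_def[symmetric])
      then show ?thesis using P(3) insert by simp
    qed
    ultimately show ?thesis by blast
  qed
qed

lemma orthogonal_span: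
  fixes z :: "nat \<Rightarrow> real"
  assumes "\<forall>y\<in>S. (\<Sum>l<N. z l * y l) = 0" "y \<in> span S"
  shows "(\<Sum>l<N. z l * y l) = 0"
  using assms(2)
proof (induction rule: span_induct_alt)
  case base
  then show ?case by (simp add: zero_fun_def)
next
  case (step c x y)
  then have "(\<Sum>l<N. z l * x l) = 0" using assms(1) by blast
  moreover have "(\<Sum>l<N. z l * (c *\<^sub>R x + y) l) = c * (\<Sum>l<N. z l * x l) + (\<Sum>l<N. z l * y l)"
    by (simp add: scaleR_fun_def plus_fun_def algebra_simps sum.distrib sum_distrib_left)
  ultimately show ?case using step(2) by simp
qed

lemma kills_span:
  assumes "\<forall>y\<in>S. kills N P y" "y \<in> span S"
  shows "kills N P y"
  using assms orthogonal_span[of S _ N y] by (simp add: kills_def mat_app_def)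

text \<open>
  The diagonal entry is the squared norm of its row.  Both equal the squared norm of a projected
  basis vector, which is at most one; so the squared row entries form a sub-probability weight.
\<close>

lemma orth_proj_row:
  assumes "orth_proj N P" "k < N"
  shows "(\<Sum>l<N. (P k l)\<^sup>2) = P k k" "0 \<le> P k k" "P k k \<le> 1"
proof -
  show 1: "(\<Sum>l<N. (P k l)\<^sup>2) = P k k"
  proof -
    have sym: "P k l = P l k" for l using assms(1) by (simp add: orth_proj_def)
    have "(\<Sum>l<N. (P k l)\<^sup>2) = (\<Sum>l<N. P k l * P l k)"
      by (intro sum.cong refl) (metis sym power2_eq_square)
    also have "\<dots> = P k k" using assms unfolding orth_proj_def by blast
    finally show ?thesis .
  qed
  show ge0: "0 \<le> P k k"
    using sum_nonneg[of "{..<N}" "\<lambda>l. (P k l)\<^sup>2"] by (simp add: 1)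
  have "(P k k)\<^sup>2 \<le> (\<Sum>l<N. (P k l)\<^sup>2)"
    using assms(2) by (intro member_le_sum) auto
  then have "P k k * P k k \<le> P k k * 1" unfolding 1 by (simp add: power2_eq_square)
  then show "P k k \<le> 1" using ge0 by (cases "P k k = 0") (auto simp: mult_le_cancel_left)
qed

section \<open>Symmetric norms\<close>

lemma coord_space_scaleR: "x \<in> coord_space m \<Longrightarrow> a *\<^sub>R x \<in> coord_space m"
  by (simp add: coord_space_def scaleR_fun_def)

text \<open>
  The symmetry hypotheses speak of unit balls; homogeneity turns them into inequalities, and, as the
  symmetries are invertible, into equalities between norms.
\<close>

lemma unit_ball_map_le:
  assumes n: "norm_on V p"
    and V: "\<And>x a. x \<in> V \<Longrightarrow> a *\<^sub>R x \<in> V" "\<And>x. x \<in> V \<Longrightarrow> T x \<in> V"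
    and T: "\<And>x a. T (a *\<^sub>R x) = a *\<^sub>R T x"
    and ball: "T ` unit_ball V p \<subseteq> unit_ball V p"
    and x: "x \<in> V"
  shows "p (T x) \<le> p x"
proof (cases "p x = 0")
  case True
  then have "x = 0" using n x by (auto simp: norm_on_def)
  then have "T x = x" using T[of 0 x] by simp
  then show ?thesis by simp
next
  case False
  then have px: "0 < p x" using n x by (auto simp: norm_on_def less_le)
  have "(1 / p x) *\<^sub>R x \<in> unit_ball V p"
    using n x px V by (simp add: unit_ball_def norm_on_def)
  then have "T ((1 / p x) *\<^sub>R x) \<in> unit_ball V p" using ball by blast
  then have "p ((1 / p x) *\<^sub>R T x) \<le> 1" by (simp add: unit_ball_def T)
  then show ?thesis using n V x px by (simp add: norm_on_def)
qed

lemma symmetric_norm_sign: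
  assumes p: "symmetric_norm m p" and x: "x \<in> coord_space m" and \<sigma>: "\<And>i. \<sigma> i \<in> {-1, 1::real}"
  shows "p (\<lambda>i. \<sigma> i * x i) = p x"
proof -
  have le: "p (\<lambda>i. \<sigma> i * x i) \<le> p x" if "x \<in> coord_space m" for x
    by (rule unit_ball_map_le[where V = "coord_space m" and T = "\<lambda>x i. \<sigma> i * x i"])
       (use p that \<sigma> in \<open>auto simp: symmetric_norm_def coord_space_scaleR scaleR_fun_def coord_space_def\<close>)
  have "(\<lambda>i. \<sigma> i * (\<sigma> i * x i)) = x"
  proof
    fix i show "\<sigma> i * (\<sigma> i * x i) = x i" using \<sigma>[of i] by auto
  qed
  moreover have "(\<lambda>i. \<sigma> i * x i) \<in> coord_space m" using x by (simp add: coord_space_def)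
  ultimately show ?thesis using le[of "\<lambda>i. \<sigma> i * x i"] le[OF x] by simp
qed

lemma symmetric_norm_perm:
  assumes p: "symmetric_norm m p" and x: "x \<in> coord_space m" and \<pi>: "\<pi> permutes {..<m}"
  shows "p (x \<circ> \<pi>) = p x"
proof -
  have V: "x \<circ> \<tau> \<in> coord_space m" if "x \<in> coord_space m" "\<tau> permutes {..<m}" for x \<tau>
    using that by (auto simp: coord_space_def permutes_not_in)
  have le: "p (x \<circ> \<tau>) \<le> p x" if "x \<in> coord_space m" "\<tau> permutes {..<m}" for x \<tau>
  proof (rule unit_ball_map_le[where V = "coord_space m" and T = "\<lambda>x. x \<circ> \<tau>"])
    show "(\<lambda>x. x \<circ> \<tau>) ` unit_ball (coord_space m) p \<subseteq> unit_ball (coord_space m) p"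
      using p that by (auto simp: symmetric_norm_def)
  qed (use p that V in \<open>auto simp: symmetric_norm_def coord_space_scaleR scaleR_fun_def[abs_def] o_def coord_space_def\<close>)
  have "x \<circ> \<pi> \<circ> inv \<pi> = x" using permutes_inv_o(1)[OF \<pi>] by (simp add: comp_assoc)
  then show ?thesis
    using le[OF V[OF x \<pi>] permutes_inv[OF \<pi>]] le[OF x \<pi>] by simp
qed

lemma symmetric_norm_abs:
  assumes "symmetric_norm m p" "x \<in> coord_space m"
  shows "p (\<lambda>i. \<bar>x i\<bar>) = p x"
proof -
  have "(\<lambda>i. \<bar>x i\<bar>) = (\<lambda>i. (if x i < 0 then -1 else 1) * x i)" by auto
  then show ?thesis using symmetric_norm_sign[OF assms, of "\<lambda>i. if x i < 0 then -1 else 1"] by simp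
qed

lemma symmetric_norm_scale:
  assumes "symmetric_norm m p" "x \<in> coord_space m"
  shows "p (\<lambda>i. a * x i) = \<bar>a\<bar> * p x"
  using assms by (auto simp: symmetric_norm_def norm_on_def scaleR_fun_def)

lemma symmetric_norm_nonneg:
  assumes "symmetric_norm m p" "x \<in> coord_space m"
  shows "0 \<le> p x"
  using assms by (auto simp: symmetric_norm_def norm_on_def)

lemma symmetric_norm_0:
  assumes "symmetric_norm m p"
  shows "p (\<lambda>_. 0) = 0"
  using symmetric_norm_scale[OF assms, of "\<lambda>_. 0" 0] by (simp add: coord_space_def)

lemma symmetric_norm_sum_le:
  assumes p: "symmetric_norm m p" and "finite T" "\<And>t. t \<in> T \<Longrightarrow> x t \<in> coord_space m"
  shows "p (\<lambda>i. \<Sum>t\<in>T. x t i) \<le> (\<Sum>t\<in>T. p (x t))"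
  using assms(2,3)
proof (induction T rule: finite_induct)
  case empty
  then show ?case using symmetric_norm_0[OF p] by simp
next
  case (insert a T)
  have "(\<lambda>i. \<Sum>t\<in>T. x t i) \<in> coord_space m" using insert by (simp add: coord_space_def)
  then have "p (x a + (\<lambda>i. \<Sum>t\<in>T. x t i)) \<le> p (x a) + p (\<lambda>i. \<Sum>t\<in>T. x t i)"
    using p insert by (simp add: symmetric_norm_def norm_on_def)
  moreover have "x a + (\<lambda>i. \<Sum>t\<in>T. x t i) = (\<lambda>i. \<Sum>t\<in>insert a T. x t i)"
    using insert by (auto simp: fun_eq_iff)
  ultimately show ?case using insert by fastforce
qed

section \<open>A transitive family of permutations\<close>

definition shift :: "nat \<Rightarrow> nat \<Rightarrow> nat \<Rightarrow> nat" where
  "shift m c j = (if j < m then (j + c) mod m else j)"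

lemma shift_less: "j < m \<Longrightarrow> shift m c j < m"
  by (simp add: shift_def)

lemma shift_inj:
  assumes "c < m" "shift m c i = shift m c j" "i < m" "j < m"
  shows "i = j"
  using assms by (auto simp: shift_def mod_if split: if_splits)

lemma shift_permutes:
  assumes "c < m"
  shows "shift m c permutes {..<m}"
proof (rule bij_imp_permutes)
  have "inj_on (shift m c) {..<m}" using shift_inj[OF assms] by (auto simp: inj_on_def)
  moreover have "shift m c ` {..<m} \<subseteq> {..<m}" by (auto simp: shift_less)
  ultimately show "bij_betw (shift m c) {..<m} {..<m}"
    by (simp add: bij_betw_def endo_inj_surj)
qed (simp add: shift_def)

lemma shift_commute: "c < m \<Longrightarrow> j < m \<Longrightarrow> shift m c j = shift m j c"
  by (simp add: shift_def add.commute)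

text \<open>
  The cyclic shifts inside the blocks together with the cyclic shifts of the blocks.  Indexed by
  \<open>t < s * b\<close>, with \<open>t mod s\<close> the inner and \<open>t div s\<close> the outer shift, they act simply transitively
  on the coordinates, so that averaging over \<open>t\<close> spreads each coordinate uniformly.
\<close>

definition block_shift :: "nat \<Rightarrow> nat \<Rightarrow> nat \<Rightarrow> nat \<Rightarrow> nat" where
  "block_shift s b t k = s * shift b (t div s) (k div s) + shift s (t mod s) (k mod s)"

lemma block_index_less:
  assumes "j < b" "i < s"
  shows "s * j + i < s * (b::nat)"
proof -
  have "s * j + i < s * Suc j" using assms by simp
  also have "\<dots> \<le> s * b" using assms by (intro mult_le_mono) auto
  finally show ?thesis .
qed

lemma div_less_block: "k < s * b \<Longrightarrow> k div s < (b::nat)"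
  by (simp add: less_mult_imp_div_less mult.commute)

lemma block_shift_bij:
  assumes "k < s * b"
  shows "bij_betw (\<lambda>t. block_shift s b t k) {..<s * b} {..<s * b}"
proof -
  have s: "0 < s" using assms by (cases s) auto
  have "inj_on (\<lambda>t. block_shift s b t k) {..<s * b}"
  proof (rule inj_onI)
    fix t t' assume t: "t \<in> {..<s * b}" "t' \<in> {..<s * b}" "block_shift s b t k = block_shift s b t' k"
    have lt: "shift s c (k mod s) < s" for c using s by (simp add: shift_less)
    from t(3) have "shift b (t div s) (k div s) = shift b (t' div s) (k div s)"
      unfolding block_shift_def
      by (metis lt s div_mult_self4 div_less add.right_neutral add.commute nat_neq_iff)
    moreover from t(3) this have "shift s (t mod s) (k mod s) = shift s (t' mod s) (k mod s)"
      by (simp add: block_shift_def)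
    moreover have "k div s < b" "t div s < b" "t' div s < b" "k mod s < s" "t mod s < s" "t' mod s < s"
      using assms t s by (auto simp: div_less_block)
    ultimately have "t div s = t' div s" "t mod s = t' mod s"
      by (metis shift_commute shift_inj)+
    then show "t = t'" by (metis div_mult_mod_eq)
  qed
  moreover have "(\<lambda>t. block_shift s b t k) ` {..<s * b} \<subseteq> {..<s * b}"
    using assms s unfolding block_shift_def
    by (auto intro!: block_index_less shift_less div_less_block)
  ultimately show ?thesis by (simp add: bij_betw_def endo_inj_surj)
qed

lemma sum_block_shift:
  assumes "k < s * b"
  shows "(\<Sum>t<s * b. f (block_shift s b t k)) = (\<Sum>l<s * b. f l)"
  by (rule sum.reindex_bij_betw[OF block_shift_bij[OF assms]])

definition signed_shift ::
  "nat \<Rightarrow> nat \<Rightarrow> nat set \<Rightarrow> nat \<Rightarrow> (nat \<Rightarrow> real) \<Rightarrow> nat \<Rightarrow> real" where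
  "signed_shift s b A t x k = flip A k * x (block_shift s b t k)"

lemma coord_space_block: "block s x j \<in> coord_space s"
  by (simp add: block_def coord_space_def)

lemma coord_space_tensor:
  assumes "z \<in> coord_space b" "0 < s"
  shows "(\<lambda>k. y (k mod s) * z (k div s)) \<in> coord_space (s * b)"
  using assms unfolding coord_space_def
  by (auto simp: less_eq_div_iff_mult_less_eq mult.commute)

lemma signed_shift_coord_space:
  assumes "x \<in> coord_space (s * b)" "0 < s"
  shows "signed_shift s b A t x \<in> coord_space (s * b)"
proof -
  have "s * b \<le> block_shift s b t k" if "s * b \<le> k" for k
  proof -
    have "b \<le> k div s" using that assms(2) by (simp add: less_eq_div_iff_mult_less_eq mult.commute)
    then have "b \<le> shift b (t div s) (k div s)" by (simp add: shift_def)
    then have "s * b \<le> s * shift b (t div s) (k div s)" by (rule mult_le_mono2)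
    then show ?thesis unfolding block_shift_def by linarith
  qed
  then show ?thesis using assms by (auto simp: coord_space_def signed_shift_def)
qed

lemma mixed_norm_signed_shift:
  assumes \<Phi>: "symmetric_norm s \<Phi>" and \<Psi>: "symmetric_norm b \<Psi>" and s: "0 < s" and t: "t < s * b"
  shows "mixed_norm s b \<Phi> \<Psi> (signed_shift s b A t x) = mixed_norm s b \<Phi> \<Psi> x"
proof -
  define v where "v j = (if j < b then \<Phi> (block s x j) else 0)" for j
  have blk: "\<Phi> (block s (signed_shift s b A t x) j) = v (shift b (t div s) j)" if j: "j < b" for j
  proof -
    have signed: "block s (signed_shift s b A t x) j
        = (\<lambda>i. flip A (s * j + i) * (block s x (shift b (t div s) j) \<circ> shift s (t mod s)) i)"
    proof
      fix i
      show "block s (signed_shift s b A t x) j i =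
        flip A (s * j + i) * (block s x (shift b (t div s) j) \<circ> shift s (t mod s)) i"
        using shift_less[of i s "t mod s"]
        by (simp add: block_def signed_shift_def block_shift_def shift_def[of s _ i])
    qed
    have "\<Phi> (block s (signed_shift s b A t x) j)
        = \<Phi> (block s x (shift b (t div s) j) \<circ> shift s (t mod s))"
      unfolding signed
      by (rule symmetric_norm_sign[OF \<Phi>])
         (auto simp: coord_space_def block_def flip_def shift_def)
    also have "\<dots> = \<Phi> (block s x (shift b (t div s) j))"
      by (rule symmetric_norm_perm[OF \<Phi> coord_space_block shift_permutes]) (simp add: s)
    finally show ?thesis using j by (simp add: v_def shift_less)
  qed
  have comp: "(\<lambda>j. if j < b then \<Phi> (block s (signed_shift s b A t x) j) else 0) = v \<circ> shift b (t div s)"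
    using blk by (auto simp: fun_eq_iff shift_def v_def)
  have "\<Psi> (v \<circ> shift b (t div s)) = \<Psi> v"
    by (rule symmetric_norm_perm[OF \<Psi> _ shift_permutes[OF div_less_block[OF t]]])
       (simp add: coord_space_def v_def)
  then show ?thesis unfolding mixed_norm_def comp v_def .
qed

text \<open>
  Every block of the tensor product is a multiple of \<open>y\<close>, hence the norm factors.
\<close>

lemma mixed_norm_tensor:
  assumes \<Phi>: "symmetric_norm s \<Phi>" and \<Psi>: "symmetric_norm b \<Psi>" and s: "0 < s"
    and y: "y \<in> coord_space s" and z: "z \<in> coord_space b"
  shows "mixed_norm s b \<Phi> \<Psi> (\<lambda>k. y (k mod s) * z (k div s)) = \<Phi> y * \<Psi> z"
proof -
  have "block s (\<lambda>k. y (k mod s) * z (k div s)) j = (\<lambda>i. z j * y i)" for j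
    using s y by (auto simp: block_def fun_eq_iff coord_space_def)
  then have "\<Phi> (block s (\<lambda>k. y (k mod s) * z (k div s)) j) = \<Phi> y * \<bar>z j\<bar>" for j
    using symmetric_norm_scale[OF \<Phi> y] by simp
  then have "(\<lambda>j. if j < b then \<Phi> (block s (\<lambda>k. y (k mod s) * z (k div s)) j) else 0)
      = (\<lambda>j. \<Phi> y * \<bar>z j\<bar>)"
    using z by (auto simp: fun_eq_iff coord_space_def)
  moreover have "\<Psi> (\<lambda>j. \<Phi> y * \<bar>z j\<bar>) = \<Phi> y * \<Psi> z"
    using symmetric_norm_scale[OF \<Psi>, of "\<lambda>j. \<bar>z j\<bar>" "\<Phi> y"] z symmetric_norm_abs[OF \<Psi> z]
      symmetric_norm_nonneg[OF \<Phi> y] by (simp add: coord_space_def)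
  ultimately show ?thesis by (simp add: mixed_norm_def)
qed

lemma tensor_in_mixed_ball:
  assumes \<Phi>: "symmetric_norm s \<Phi>" and \<Psi>: "symmetric_norm b \<Psi>" and s: "0 < s"
    and y: "y \<in> unit_ball (coord_space s) \<Phi>" and z: "z \<in> unit_ball (coord_space b) \<Psi>"
  shows "(\<lambda>k. y (k mod s) * z (k div s)) \<in> unit_ball (coord_space (s * b)) (mixed_norm s b \<Phi> \<Psi>)"
proof -
  have "\<Phi> y * \<Psi> z \<le> 1 * 1"
    using y z symmetric_norm_nonneg[OF \<Psi>] by (intro mult_mono) (auto simp: unit_ball_def)
  then show ?thesis
    using y z s by (simp add: unit_ball_def mixed_norm_tensor[OF \<Phi> \<Psi> s] coord_space_tensor)
qed

lemma signed_shift_in_mixed_ball: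
  assumes "symmetric_norm s \<Phi>" "symmetric_norm b \<Psi>" "0 < s" "t < s * b"
    and "x \<in> unit_ball (coord_space (s * b)) (mixed_norm s b \<Phi> \<Psi>)"
  shows "signed_shift s b A t x \<in> unit_ball (coord_space (s * b)) (mixed_norm s b \<Phi> \<Psi>)"
  using assms by (simp add: unit_ball_def mixed_norm_signed_shift signed_shift_coord_space)

text \<open>
  The constant vector is the average of \<open>\<bar>x\<bar>\<close> over all cyclic shifts: a convex
  combination of vectors of the same norm.
\<close>

lemma symmetric_norm_mean_le:
  assumes p: "symmetric_norm m p" and x: "x \<in> coord_space m"
  shows "p (\<lambda>i. if i < m then (\<Sum>k<m. \<bar>x k\<bar>) / m else 0) \<le> p x"
proof (cases "m = 0")
  case True
  then show ?thesis using symmetric_norm_0[OF p] symmetric_norm_nonneg[OF p x] by simp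
next
  case False
  define e where "e = (\<lambda>i. if i < m then (\<Sum>k<m. \<bar>x k\<bar>) else 0)"
  have a: "(\<lambda>i. \<bar>x i\<bar>) \<in> coord_space m" using x by (simp add: coord_space_def)
  have e_sum: "e = (\<lambda>i. \<Sum>c<m. ((\<lambda>i. \<bar>x i\<bar>) \<circ> shift m c) i)"
  proof
    fix i
    show "e i = (\<Sum>c<m. ((\<lambda>i. \<bar>x i\<bar>) \<circ> shift m c) i)"
    proof (cases "i < m")
      case True
      have "(\<Sum>c<m. \<bar>x (shift m c i)\<bar>) = (\<Sum>c<m. \<bar>x (shift m i c)\<bar>)"
        by (rule sum.cong) (simp_all add: shift_commute True)
      also have "\<dots> = (\<Sum>k<m. \<bar>x k\<bar>)"
        using sum.permute[OF shift_permutes[OF True], of "\<lambda>k. \<bar>x k\<bar>"] by simp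
      finally show ?thesis using True by (simp add: e_def)
    next
      case False
      then show ?thesis using x by (simp add: e_def shift_def coord_space_def)
    qed
  qed
  have "p e \<le> (\<Sum>c<m. p ((\<lambda>i. \<bar>x i\<bar>) \<circ> shift m c))"
    unfolding e_sum
  proof (rule symmetric_norm_sum_le[OF p])
    fix c assume "c \<in> {..<m}"
    show "(\<lambda>i. \<bar>x i\<bar>) \<circ> shift m c \<in> coord_space m" using x by (simp add: coord_space_def shift_def)
  qed simp
  also have "\<dots> = (\<Sum>c<m. p x)"
    by (intro sum.cong refl) (simp add: symmetric_norm_perm[OF p a] shift_permutes symmetric_norm_abs[OF p x])
  finally have "p e \<le> (\<Sum>c<m. p x)" .
  then have "p e \<le> real m * p x" by simp
  moreover have "p (\<lambda>i. (1 / m) * e i) = (1 / m) * p e"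
    using symmetric_norm_scale[OF p, of e "1 / m"] by (simp add: e_def coord_space_def)
  moreover have "(\<lambda>i. (1 / m) * e i) = (\<lambda>i. if i < m then (\<Sum>k<m. \<bar>x k\<bar>) / m else 0)"
    by (auto simp: e_def)
  ultimately have "real m * p (\<lambda>i. if i < m then (\<Sum>k<m. \<bar>x k\<bar>) / m else 0) \<le> real m * p x"
    using False by simp
  then show ?thesis using False by (simp add: mult_le_cancel_left)
qed

section \<open>Tensor products and the supremum over the mixed ball\<close>

lemma lq_norm_nonneg: "0 \<le> lq_norm q m x"
  by (simp add: lq_norm_def)

lemma lq_norm_powr:
  assumes "0 < q"
  shows "lq_norm q m x powr q = (\<Sum>k<m. \<bar>x k\<bar> powr q)"
proof -
  have "0 \<le> (\<Sum>k<m. \<bar>x k\<bar> powr q)" by (rule sum_nonneg) simp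
  then show ?thesis using assms by (simp add: lq_norm_def powr_powr)
qed

lemma sum_blocks:
  fixes f :: "nat \<Rightarrow> real"
  shows "(\<Sum>k<s * b. f k) = (\<Sum>j<b. \<Sum>i<s. f (s * j + i))"
proof (induction b)
  case (Suc b)
  have "(\<Sum>k<s * Suc b. f k) = (\<Sum>k<s * b. f k) + (\<Sum>k=s*b..<s*b+s. f k)"
    by (subst sum.atLeastLessThan_concat[symmetric, of 0 "s*b", simplified lessThan_atLeast0[symmetric]])
       (auto simp: add.commute)
  also have "(\<Sum>k=s*b..<s*b+s. f k) = (\<Sum>i<s. f (s * b + i))"
    using sum.shift_bounds_nat_ivl[of f 0 "s * b" s] by (simp add: lessThan_atLeast0 add.commute)
  finally show ?case using Suc by simp
qed simp

lemma lq_norm_tensor: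
  assumes "0 < q" "0 < s"
  shows "lq_norm q (s * b) (\<lambda>k. y (k mod s) * z (k div s)) = lq_norm q s y * lq_norm q b z"
proof -
  have "(\<Sum>k<s * b. \<bar>y (k mod s) * z (k div s)\<bar> powr q)
      = (\<Sum>j<b. \<Sum>i<s. \<bar>y i\<bar> powr q * \<bar>z j\<bar> powr q)"
    using assms by (simp add: sum_blocks abs_mult powr_mult)
  also have "\<dots> = (\<Sum>i<s. \<bar>y i\<bar> powr q) * (\<Sum>j<b. \<bar>z j\<bar> powr q)"
    by (simp add: sum_distrib_left[symmetric] sum_distrib_right[symmetric])
  finally show ?thesis by (simp add: lq_norm_def powr_mult sum_nonneg)
qed

text \<open>
  Take \<open>z\<close> to be the vector of block norms and \<open>y\<close> the normalized block with the largest
  \<open>q\<close>-norm: replacing every normalized block by that one can only increase the \<open>q\<close>-norm of \<open>x\<close>.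
\<close>

lemma lq_norm_le_tensor:
  assumes \<Phi>: "symmetric_norm s \<Phi>" and q: "0 < q" and s: "0 < s" and b: "0 < b"
    and x: "mixed_norm s b \<Phi> \<Psi> x \<le> 1"
  shows "\<exists>y\<in>unit_ball (coord_space s) \<Phi>. \<exists>z\<in>unit_ball (coord_space b) \<Psi>.
           lq_norm q (s * b) x \<le> lq_norm q s y * lq_norm q b z"
proof -
  define z where "z j = (if j < b then \<Phi> (block s x j) else 0)" for j
  \<comment> \<open>A vanishing block gives \<open>u j = 0\<close>, which is still in the unit ball.\<close>
  define u where "u j = (\<lambda>i. (1 / z j) * block s x j i)" for j
  have z0: "0 \<le> z j" for j
    using symmetric_norm_nonneg[OF \<Phi> coord_space_block] by (simp add: z_def)
  have z: "z \<in> unit_ball (coord_space b) \<Psi>"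
    using x by (auto simp: unit_ball_def coord_space_def mixed_norm_def z_def[abs_def])
  have u: "u j \<in> unit_ball (coord_space s) \<Phi>" if "j < b" for j
    using symmetric_norm_scale[OF \<Phi> coord_space_block, of "1 / z j" x j] z0[of j] that
    by (auto simp: u_def unit_ball_def coord_space_def block_def z_def)
  have xu: "x (s * j + i) = z j * u j i" if "j < b" "i < s" for i j
  proof (cases "z j = 0")
    case True
    then have "block s x j = 0" using that \<Phi> coord_space_block[of s x j]
      by (simp add: z_def symmetric_norm_def norm_on_def)
    then have "block s x j i = 0" by simp
    then show ?thesis using that True by (simp add: block_def)
  next
    case False
    then show ?thesis using that by (simp add: u_def block_def)
  qed
  define M where "M = Max ((\<lambda>j. lq_norm q s (u j)) ` {..<b})"
  have "M \<in> (\<lambda>j. lq_norm q s (u j)) ` {..<b}" unfolding M_def using b by (intro Max_in) auto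
  then obtain j0 where j0: "j0 < b" "M = lq_norm q s (u j0)" by auto
  have M: "(\<Sum>i<s. \<bar>u j i\<bar> powr q) \<le> M powr q" if "j < b" for j
    unfolding lq_norm_powr[OF q, symmetric] using that q lq_norm_nonneg
    by (intro powr_mono2) (auto simp: M_def)
  have "(\<Sum>k<s * b. \<bar>x k\<bar> powr q) = (\<Sum>j<b. \<Sum>i<s. \<bar>z j\<bar> powr q * \<bar>u j i\<bar> powr q)"
    by (simp add: sum_blocks xu abs_mult powr_mult)
  also have "\<dots> = (\<Sum>j<b. \<bar>z j\<bar> powr q * (\<Sum>i<s. \<bar>u j i\<bar> powr q))"
    by (simp add: sum_distrib_left)
  also have "\<dots> \<le> (\<Sum>j<b. \<bar>z j\<bar> powr q * M powr q)"
    using M by (intro sum_mono mult_left_mono) auto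
  also have "\<dots> = (M * lq_norm q b z) powr q"
    using q lq_norm_nonneg j0 by (simp add: powr_mult lq_norm_powr sum_distrib_right mult.commute)
  finally have "lq_norm q (s * b) x powr q \<le> (M * lq_norm q b z) powr q"
    using q by (simp add: lq_norm_powr)
  then have "lq_norm q (s * b) x \<le> M * lq_norm q b z"
    using q lq_norm_nonneg j0 by (meson powr_less_mono2 not_le mult_nonneg_nonneg)
  then show ?thesis using z u[OF j0(1)] j0 by blast
qed

lemma SUP_lq_norm_mixed_ball:
  assumes \<Phi>: "symmetric_norm s \<Phi>" and \<Psi>: "symmetric_norm b \<Psi>" and q: "0 < q" and s: "0 < s" and b: "0 < b"
  shows "(SUP x\<in>unit_ball (coord_space (s * b)) (mixed_norm s b \<Phi> \<Psi>). ereal (lq_norm q (s * b) x))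
    = (SUP y\<in>unit_ball (coord_space s) \<Phi>. ereal (lq_norm q s y))
        * (SUP z\<in>unit_ball (coord_space b) \<Psi>. ereal (lq_norm q b z))"
    (is "?L = ?S * ?T")
proof (rule antisym)
  have ne: "unit_ball (coord_space m) p \<noteq> {}" if "symmetric_norm m p" for m and p :: "(nat \<Rightarrow> real) \<Rightarrow> real"
    using symmetric_norm_0[OF that] by (force simp: unit_ball_def coord_space_def)
  have nonneg: "0 \<le> (SUP x\<in>unit_ball (coord_space m) p. ereal (lq_norm q m x))"
    if "symmetric_norm m p" for m and p :: "(nat \<Rightarrow> real) \<Rightarrow> real"
  proof -
    from ne[OF that] obtain x where "x \<in> unit_ball (coord_space m) p" by blast
    then show ?thesis by (rule SUP_upper2) (simp add: lq_norm_nonneg)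
  qed
  have pos: "0 \<le> ?S" "0 \<le> ?T"
    by (rule nonneg[OF \<Phi>], rule nonneg[OF \<Psi>])
  show "?L \<le> ?S * ?T"
  proof (rule SUP_least)
    fix x assume "x \<in> unit_ball (coord_space (s * b)) (mixed_norm s b \<Phi> \<Psi>)"
    then obtain y z where yz: "y\<in>unit_ball (coord_space s) \<Phi>" "z\<in>unit_ball (coord_space b) \<Psi>"
      "lq_norm q (s * b) x \<le> lq_norm q s y * lq_norm q b z"
      using lq_norm_le_tensor[OF \<Phi> q s b, of \<Psi> x] by (auto simp: unit_ball_def)
    then have "ereal (lq_norm q (s * b) x) \<le> ereal (lq_norm q s y) * ereal (lq_norm q b z)" by simp
    also have "\<dots> \<le> ?S * ?T"
      using yz lq_norm_nonneg pos by (intro ereal_mult_mono SUP_upper) auto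
    finally show "ereal (lq_norm q (s * b) x) \<le> ?S * ?T" .
  qed
  have "?S * ?T = (SUP z\<in>unit_ball (coord_space b) \<Psi>. ?S * ereal (lq_norm q b z))"
    using ne[OF \<Psi>] pos lq_norm_nonneg by (intro SUP_ereal_mult_left[symmetric]) auto
  also have "\<dots> \<le> ?L"
  proof (rule SUP_least)
    fix z assume z: "z \<in> unit_ball (coord_space b) \<Psi>"
    have "?S * ereal (lq_norm q b z) = (SUP y\<in>unit_ball (coord_space s) \<Phi>. ereal (lq_norm q s y) * ereal (lq_norm q b z))"
      using ne[OF \<Phi>] lq_norm_nonneg by (intro Sup_ereal_mult_right') auto
    also have "\<dots> \<le> ?L"
    proof (rule SUP_least)
      fix y assume y: "y \<in> unit_ball (coord_space s) \<Phi>"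
      show "ereal (lq_norm q s y) * ereal (lq_norm q b z) \<le> ?L"
        by (rule SUP_upper2[OF tensor_in_mixed_ball[OF \<Phi> \<Psi> s y z]]) (simp add: lq_norm_tensor[OF q s])
    qed
    finally show "?S * ereal (lq_norm q b z) \<le> ?L" .
  qed
  finally show "?S * ?T \<le> ?L" .
qed

section \<open>Averaging over the group of signed shifts\<close>

text \<open>
  For \<open>k \<noteq> l\<close> toggling the membership of \<open>k\<close> reverses the sign of every term.
\<close>

lemma sum_flip_flip:
  assumes "finite I" "k \<in> I"
  shows "(\<Sum>A\<in>Pow I. flip A k * flip A l) = (if k = l then 2 ^ card I else 0)"
proof (cases "k = l")
  case True
  then show ?thesis using assms by (simp add: card_Pow)
next
  case False
  define T where "T A = (if k \<in> A then A - {k} else insert k A)" for A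
  have "(\<Sum>A\<in>Pow I. flip A k * flip A l) = (\<Sum>A\<in>Pow I. - (flip A k * flip A l))"
    by (rule sum.reindex_bij_witness[of _ T T])
       (use assms False in \<open>auto simp: T_def flip_def split: if_splits\<close>)
  then show ?thesis using False by (simp add: sum_negf)
qed

text \<open>
  The signs remove the off-diagonal entries of \<open>P\<close> and the transitive shifts decouple the diagonal
  from \<open>w\<close> and \<open>x\<close>.  In terms of averages over \<open>g\<close>, the mean of the inner product of \<open>g w\<close> with
  \<open>P (g x)\<close> is the normalized trace of \<open>P\<close> times the inner product of \<open>w\<close> with \<open>x\<close>.
\<close>

lemma sum_signed_shift_trace:
  shows "(\<Sum>A\<in>Pow {..<s * b}. \<Sum>t<s * b. \<Sum>k<s * b.
            signed_shift s b A t w k * mat_app (s * b) P (signed_shift s b A t x) k)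
       = 2 ^ (s * b) * (\<Sum>k<s * b. P k k) * (\<Sum>l<s * b. w l * x l)"
proof -
  define N where "N = s * b"
  define \<pi> where "\<pi> = block_shift s b"
  have "(\<Sum>A\<in>Pow {..<N}. \<Sum>t<N. \<Sum>k<N.
            signed_shift s b A t w k * mat_app N P (signed_shift s b A t x) k)
      = (\<Sum>A\<in>Pow {..<N}. \<Sum>t<N. \<Sum>k<N. \<Sum>l<N.
            P k l * w (\<pi> t k) * x (\<pi> t l) * (flip A k * flip A l))"
    by (simp add: signed_shift_def mat_app_def \<pi>_def sum_distrib_left mult_ac)
  also have "\<dots> = (\<Sum>t<N. \<Sum>k<N. \<Sum>l<N. \<Sum>A\<in>Pow {..<N}.
            P k l * w (\<pi> t k) * x (\<pi> t l) * (flip A k * flip A l))"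
    by (subst sum.swap, rule sum.cong[OF refl], subst sum.swap, rule sum.cong[OF refl], rule sum.swap)
  also have "\<dots> = (\<Sum>t<N. \<Sum>k<N. \<Sum>l<N.
            P k l * w (\<pi> t k) * x (\<pi> t l) * (if k = l then 2 ^ N else 0))"
    by (intro sum.cong refl) (simp add: sum_distrib_left[symmetric] sum_flip_flip)
  also have "\<dots> = (\<Sum>t<N. \<Sum>k<N. P k k * 2 ^ N * (w (\<pi> t k) * x (\<pi> t k)))"
    by (intro sum.cong refl) (simp add: if_distrib mult_ac cong: if_cong)
  also have "\<dots> = (\<Sum>k<N. P k k * 2 ^ N * (\<Sum>t<N. w (\<pi> t k) * x (\<pi> t k)))"
    by (subst sum.swap) (simp add: sum_distrib_left)
  also have "\<dots> = (\<Sum>k<N. P k k * 2 ^ N * (\<Sum>l<N. w l * x l))"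
    using sum_block_shift[of _ s b "\<lambda>i. w i * x i"] by (intro sum.cong refl) (simp add: N_def \<pi>_def)
  finally show ?thesis
    by (simp add: N_def sum_distrib_right[symmetric] mult_ac)
qed

text \<open>
  On average over the orbit, \<open>P\<close> is bounded on \<open>l\<^sub>p\<close> with a constant that does not depend on the
  dimension, although a fixed orthogonal projection need not be.  Khinchine's inequality in the signs
  brings in the squares of the entries of a row; these form a sub-probability weight, so Jensen's
  inequality applies, and the shifts replace each \<open>\<bar>x l\<bar> powr p\<close> by its mean.
\<close>

lemma sum_signed_shift_moment_le:
  assumes P: "orth_proj (s * b) P" and p: "2 \<le> p"
  shows "(\<Sum>A\<in>Pow {..<s * b}. \<Sum>t<s * b. \<Sum>k<s * b. \<bar>mat_app (s * b) P (signed_shift s b A t x) k\<bar> powr p)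
       \<le> 2 ^ (s * b) * khinchine_const p * real (s * b) * (\<Sum>l<s * b. \<bar>x l\<bar> powr p)"
proof -
  define N where "N = s * b"
  define \<pi> where "\<pi> = block_shift s b"
  define X where "X = (\<Sum>l<N. \<bar>x l\<bar> powr p)"
  have X: "0 \<le> X" unfolding X_def by (rule sum_nonneg) simp
  have P: "orth_proj N P" using P by (simp add: N_def)
  have K: "0 \<le> khinchine_const p" using khinchine_const_pos[of p] p by simp
  have step: "(\<Sum>A\<in>Pow {..<N}. \<bar>mat_app N P (signed_shift s b A t x) k\<bar> powr p)
      \<le> 2 ^ N * khinchine_const p * (\<Sum>l<N. (P k l)\<^sup>2 * \<bar>x (\<pi> t l)\<bar> powr p)" if "k < N" for k t
  proof -
    have "(\<Sum>A\<in>Pow {..<N}. \<bar>mat_app N P (signed_shift s b A t x) k\<bar> powr p)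
        = (\<Sum>A\<in>Pow {..<N}. \<bar>\<Sum>l<N. flip A l * (P k l * x (\<pi> t l))\<bar> powr p)"
      by (simp add: mat_app_def signed_shift_def \<pi>_def mult_ac)
    also have "\<dots> \<le> 2 ^ N * khinchine_const p * (\<Sum>l<N. (P k l * x (\<pi> t l))\<^sup>2) powr (p / 2)"
      using khinchine[of "{..<N}" p "\<lambda>l. P k l * x (\<pi> t l)"] p by simp
    also have "(\<Sum>l<N. (P k l * x (\<pi> t l))\<^sup>2) = (\<Sum>l<N. (P k l)\<^sup>2 * (x (\<pi> t l))\<^sup>2)"
      by (simp add: power_mult_distrib)
    also have "2 ^ N * khinchine_const p * (\<Sum>l<N. (P k l)\<^sup>2 * (x (\<pi> t l))\<^sup>2) powr (p / 2)
        \<le> 2 ^ N * khinchine_const p * (\<Sum>l<N. (P k l)\<^sup>2 * ((x (\<pi> t l))\<^sup>2) powr (p / 2))"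
      using K p orth_proj_row[OF P that] by (intro mult_left_mono jensen_powr) auto
    also have "(\<Sum>l<N. (P k l)\<^sup>2 * ((x (\<pi> t l))\<^sup>2) powr (p / 2)) = (\<Sum>l<N. (P k l)\<^sup>2 * \<bar>x (\<pi> t l)\<bar> powr p)"
    proof (intro sum.cong refl arg_cong2[of _ _ _ _ "(*)"])
      fix l
      have "((x (\<pi> t l))\<^sup>2) powr (p / 2) = ((x (\<pi> t l))\<^sup>2 powr (1 / 2)) powr p"
        by (subst powr_powr) simp
      also have "((x (\<pi> t l))\<^sup>2 powr (1 / 2)) = \<bar>x (\<pi> t l)\<bar>"
        by (subst powr_half_sqrt) auto
      finally show "((x (\<pi> t l))\<^sup>2) powr (p / 2) = \<bar>x (\<pi> t l)\<bar> powr p" .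
    qed
    finally show ?thesis .
  qed
  have "(\<Sum>A\<in>Pow {..<N}. \<Sum>t<N. \<Sum>k<N. \<bar>mat_app N P (signed_shift s b A t x) k\<bar> powr p)
      = (\<Sum>t<N. \<Sum>k<N. \<Sum>A\<in>Pow {..<N}. \<bar>mat_app N P (signed_shift s b A t x) k\<bar> powr p)"
    by (subst sum.swap, rule sum.cong[OF refl], rule sum.swap)
  also have "\<dots> \<le> (\<Sum>t<N. \<Sum>k<N. 2 ^ N * khinchine_const p * (\<Sum>l<N. (P k l)\<^sup>2 * \<bar>x (\<pi> t l)\<bar> powr p))"
    by (intro sum_mono step) simp
  also have "\<dots> = 2 ^ N * khinchine_const p * (\<Sum>t<N. \<Sum>k<N. \<Sum>l<N. (P k l)\<^sup>2 * \<bar>x (\<pi> t l)\<bar> powr p)"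
    by (simp only: sum_distrib_left[symmetric])
  also have "(\<Sum>t<N. \<Sum>k<N. \<Sum>l<N. (P k l)\<^sup>2 * \<bar>x (\<pi> t l)\<bar> powr p)
      = (\<Sum>k<N. \<Sum>l<N. \<Sum>t<N. (P k l)\<^sup>2 * \<bar>x (\<pi> t l)\<bar> powr p)"
    by (subst sum.swap, rule sum.cong[OF refl], rule sum.swap)
  also have "\<dots> = (\<Sum>k<N. \<Sum>l<N. (P k l)\<^sup>2 * X)"
    using sum_block_shift[of _ s b "\<lambda>i. \<bar>x i\<bar> powr p"]
    by (intro sum.cong refl) (simp add: sum_distrib_left[symmetric] N_def \<pi>_def X_def)
  also have "\<dots> = (\<Sum>k<N. P k k * X)"
    by (intro sum.cong refl) (simp add: sum_distrib_right[symmetric] orth_proj_row[OF P])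
  also have "2 ^ N * khinchine_const p * \<dots> \<le> 2 ^ N * khinchine_const p * (\<Sum>k<N. 1 * X)"
    using K X orth_proj_row[OF P] by (intro mult_left_mono sum_mono mult_right_mono) auto
  finally show ?thesis by (simp add: N_def X_def mult.assoc)
qed

text \<open>
  The case \<open>1 < q\<close> of the width estimate: some vector in the orbit of \<open>w\<close> is far from \<open>Q\<close>.  The
  dual vector is \<open>x = sgn w * \<bar>w\<bar> powr (q - 1)\<close>, so the inner product of \<open>w\<close> with \<open>x\<close> and the
  \<open>p\<close>-th power sum of \<open>x\<close>, \<open>p\<close> the conjugate exponent, both equal the \<open>q\<close>-th power sum \<open>W\<close> of
  \<open>w\<close>.  If every \<open>g w\<close> had a close approximant \<open>y\<close> in \<open>Q\<close>, then \<open>g w\<close> could be replaced by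
  \<open>g w - y\<close> in the trace identity, as \<open>P\<close> kills \<open>y\<close>; Young's inequality and the moment bound
  then make the average smaller than \<open>\<epsilon> * W\<close>.  Young's inequality takes the place of Hoelder's
  because its right side is additive and can be summed over the orbit directly.
\<close>

lemma orbit_far_from_kernel:
  fixes q \<epsilon> :: real
  assumes q: "1 < q" "q \<le> 2" and \<epsilon>: "0 < \<epsilon>"
  shows "\<exists>c>0. \<forall>s b P w. 0 < s * b \<longrightarrow> orth_proj (s * b) P \<longrightarrow>
           \<epsilon> * real (s * b) \<le> (\<Sum>k<s * b. P k k) \<longrightarrow>
           (\<exists>A. \<exists>t<s * b. \<forall>y. kills (s * b) P y \<longrightarrow>
              c * lq_norm q (s * b) w \<le> lq_norm q (s * b) (signed_shift s b A t w - y))"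
proof -
  define p where "p = q / (q - 1)"
  have p: "2 \<le> p" "1 / q + 1 / p = 1" "(q - 1) * p = q"
    using q by (auto simp: p_def field_simps)
  define K where "K = khinchine_const p"
  have K: "0 < K" using khinchine_const_pos p by (simp add: K_def)
  \<comment> \<open>The weight \<open>\<theta>\<close> in Young's inequality balances the error term against the moment term:
    each contributes at most a quarter of \<open>\<epsilon>\<close>.\<close>
  define \<theta> where "\<theta> = (\<epsilon> / (4 * K)) powr (1 / p)"
  define c where "c = \<theta> * (\<epsilon> / 4) powr (1 / q)"
  have \<theta>: "0 < \<theta>" "\<theta> powr p * K = \<epsilon> / 4"
    using K \<epsilon> p by (auto simp: \<theta>_def powr_powr field_simps)
  have c: "0 < c" "(c / \<theta>) powr q = \<epsilon> / 4"
    using \<theta> \<epsilon> q by (auto simp: c_def powr_powr)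
  have "\<exists>A. \<exists>t<s * b. \<forall>y. kills (s * b) P y \<longrightarrow>
              c * lq_norm q (s * b) w \<le> lq_norm q (s * b) (signed_shift s b A t w - y)"
    if N0: "0 < s * b" and P: "orth_proj (s * b) P" and tr: "\<epsilon> * real (s * b) \<le> (\<Sum>k<s * b. P k k)"
    for s b P w
  proof (rule ccontr)
    define N where "N = s * b"
    assume "\<not> ?thesis"
    then have "\<forall>A t. \<exists>y. t < N \<longrightarrow> kills N P y \<and> lq_norm q N (signed_shift s b A t w - y) < c * lq_norm q N w"
      unfolding N_def by (meson not_le)
    then obtain y where y: "\<And>A t. t < N \<Longrightarrow> kills N P (y A t)"
      "\<And>A t. t < N \<Longrightarrow> lq_norm q N (signed_shift s b A t w - y A t) < c * lq_norm q N w"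
      by metis
    define W where "W = (\<Sum>k<N. \<bar>w k\<bar> powr q)"
    have "0 < c * lq_norm q N w"
      using y(2)[of 0 "{}"] N0 lq_norm_nonneg[of q N "signed_shift s b {} 0 w - y {} 0"] by (simp add: N_def)
    then have "0 < lq_norm q N w" using c(1) by (simp add: zero_less_mult_iff)
    then have "0 < lq_norm q N w powr q" by simp
    then have W: "0 < W" using q by (simp add: W_def lq_norm_powr)
    define x where "x k = sgn (w k) * \<bar>w k\<bar> powr (q - 1)" for k
    have xp: "\<bar>x k\<bar> powr p = \<bar>w k\<bar> powr q" for k
      using p by (simp add: x_def abs_mult abs_sgn_eq powr_powr)
    have wx: "w k * x k = \<bar>w k\<bar> powr q" for k
    proof -
      have "w k * x k = \<bar>w k\<bar> * \<bar>w k\<bar> powr (q - 1)" by (simp add: x_def abs_sgn)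
      then show ?thesis by (cases "w k = 0") (auto simp: powr_diff)
    qed
    define d where "d A t = signed_shift s b A t w - y A t" for A t
    define z where "z A t = mat_app N P (signed_shift s b A t x)" for A t
    have dW: "(\<Sum>k<N. \<bar>d A t k / \<theta>\<bar> powr q) \<le> \<epsilon> / 4 * W" if "t < N" for A t
    proof -
      have "(\<Sum>k<N. \<bar>d A t k\<bar> powr q) \<le> (c * lq_norm q N w) powr q"
        using y(2)[OF that, of A] q lq_norm_nonneg[of q N "d A t"]
        unfolding lq_norm_powr[of q N "d A t", symmetric, OF less_trans[OF zero_less_one q(1)]]
        by (intro powr_mono2) (auto simp: d_def)
      also have "\<dots> = c powr q * W"
        using q c lq_norm_nonneg by (simp add: powr_mult lq_norm_powr W_def)
      finally have "(\<Sum>k<N. \<bar>d A t k\<bar> powr q) / \<theta> powr q \<le> c powr q * W / \<theta> powr q"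
        using \<theta> by (intro divide_right_mono) auto
      moreover have "c powr q * W / \<theta> powr q = \<epsilon> / 4 * W"
      proof -
        have "c powr q * W / \<theta> powr q = (c / \<theta>) powr q * W"
          using c(1) \<theta>(1) by (simp add: powr_divide)
        then show ?thesis by (simp only: c(2))
      qed
      moreover have "(\<Sum>k<N. \<bar>d A t k / \<theta>\<bar> powr q) = (\<Sum>k<N. \<bar>d A t k\<bar> powr q) / \<theta> powr q"
        using \<theta> by (simp add: powr_divide sum_divide_distrib)
      ultimately show ?thesis by simp
    qed
    have each: "(\<Sum>k<N. signed_shift s b A t w k * z A t k)
        \<le> \<epsilon> / 4 * W + \<theta> powr p * (\<Sum>k<N. \<bar>z A t k\<bar> powr p)" if t: "t < N" for A t
    proof -
      have "(\<Sum>k<N. y A t k * z A t k) = (\<Sum>k<N. mat_app N P (y A t) k * signed_shift s b A t x k)"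
        unfolding z_def using P by (intro inner_mat_app) (simp add: N_def)
      also have "\<dots> = 0" using y(1)[OF t, of A] by (simp add: kills_def)
      finally have "(\<Sum>k<N. signed_shift s b A t w k * z A t k) = (\<Sum>k<N. d A t k * z A t k)"
        by (simp add: d_def left_diff_distrib sum_subtractf)
      also have "\<dots> \<le> (\<Sum>k<N. \<bar>d A t k / \<theta>\<bar> powr q + \<theta> powr p * \<bar>z A t k\<bar> powr p)"
      proof (rule sum_mono)
        fix k
        have "d A t k * z A t k \<le> \<bar>d A t k / \<theta>\<bar> * (\<theta> * \<bar>z A t k\<bar>)"
          using \<theta> by (simp add: abs_mult[symmetric] abs_ge_self)
        also have "\<dots> \<le> \<bar>d A t k / \<theta>\<bar> powr q / q + (\<theta> * \<bar>z A t k\<bar>) powr p / p"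
          using q p \<theta> by (intro Youngs_inequality) auto
        also have "\<dots> \<le> \<bar>d A t k / \<theta>\<bar> powr q / 1 + (\<theta> * \<bar>z A t k\<bar>) powr p / 1"
          using q p by (intro add_mono divide_left_mono) auto
        finally show "d A t k * z A t k \<le> \<bar>d A t k / \<theta>\<bar> powr q + \<theta> powr p * \<bar>z A t k\<bar> powr p"
          using \<theta> by (simp add: powr_mult)
      qed
      also have "\<dots> \<le> \<epsilon> / 4 * W + \<theta> powr p * (\<Sum>k<N. \<bar>z A t k\<bar> powr p)"
        using dW[OF t, of A] by (simp add: sum.distrib sum_distrib_left)
      finally show ?thesis .
    qed
    have "2 ^ N * (\<epsilon> * real N) * W \<le> 2 ^ N * (\<Sum>k<N. P k k) * W"
      using tr W by (intro mult_right_mono mult_left_mono) (auto simp: N_def)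
    also have "\<dots> = (\<Sum>A\<in>Pow {..<N}. \<Sum>t<N. \<Sum>k<N. signed_shift s b A t w k * z A t k)"
      unfolding N_def z_def sum_signed_shift_trace by (simp add: wx W_def N_def)
    also have "\<dots> \<le> (\<Sum>A\<in>Pow {..<N}. \<Sum>t<N. \<epsilon> / 4 * W + \<theta> powr p * (\<Sum>k<N. \<bar>z A t k\<bar> powr p))"
      by (intro sum_mono each) simp
    also have "\<dots> = 2 ^ N * real N * (\<epsilon> / 4 * W)
        + \<theta> powr p * (\<Sum>A\<in>Pow {..<N}. \<Sum>t<N. \<Sum>k<N. \<bar>z A t k\<bar> powr p)"
      by (simp add: sum.distrib sum_distrib_left card_Pow)
    also have "\<dots> \<le> 2 ^ N * real N * (\<epsilon> / 4 * W) + \<theta> powr p * (2 ^ N * K * real N * W)"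
      using sum_signed_shift_moment_le[OF P p(1), of x]
      by (intro add_left_mono mult_left_mono) (simp_all add: z_def K_def W_def xp N_def)
    also have "\<dots> = 2 ^ N * real N * (\<epsilon> / 4 * W) + (\<theta> powr p * K) * (2 ^ N * real N * W)"
      by (simp add: mult_ac)
    also have "\<dots> = (2 ^ N * real N * W) * (\<epsilon> / 2)"
      by (simp only: \<theta>) (simp add: field_simps)
    finally have "(2 ^ N * real N * W) * \<epsilon> \<le> (2 ^ N * real N * W) * (\<epsilon> / 2)"
      by (simp add: mult_ac)
    moreover have "0 < 2 ^ N * real N * W" using W N0 by (simp add: N_def)
    ultimately have "\<epsilon> \<le> \<epsilon> / 2" by (simp only: mult_le_cancel_left_pos)
    then show False using \<epsilon> by simp
  qed
  then show ?thesis using c(1) by blast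
qed

section \<open>Distance of sign vectors to a subspace in the norm of \<open>l\<^sub>1\<close>\<close>

text \<open>
  A section of the cube by a subspace of codimension at most \<open>card S\<close> has a point with at least
  \<open>N - card S\<close> coordinates of modulus one.  Among the points of the section take one with the largest
  number of such coordinates.  If there were fewer, some nonzero \<open>h\<close> in the subspace would vanish on
  all of them, and moving along \<open>h\<close> until the next face is met would add a coordinate.
\<close>

lemma cube_section_vertex:
  assumes S: "finite S"
  shows "\<exists>z::nat\<Rightarrow>real. (\<forall>k<N. \<bar>z k\<bar> \<le> 1) \<and> (\<forall>y\<in>S. (\<Sum>k<N. z k * y k) = 0) \<and>
           N \<le> card {k. k < N \<and> \<bar>z k\<bar> = 1} + card S"
proof -
  define good where "good z \<longleftrightarrow> (\<forall>k<N. \<bar>z k\<bar> \<le> 1) \<and> (\<forall>y\<in>S. (\<Sum>k<N. z k * y k) = 0)"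
    for z :: "nat \<Rightarrow> real"
  define tight where "tight z = {k. k < N \<and> \<bar>z k\<bar> = 1}" for z :: "nat \<Rightarrow> real"
  have fin: "finite (tight z)" for z by (simp add: tight_def)
  have "good (\<lambda>_. 0)" by (simp add: good_def)
  moreover have "\<forall>z. good z \<longrightarrow> card (tight z) < Suc N"
  proof (intro allI impI)
    fix z
    have "card (tight z) \<le> card {..<N}" by (rule card_mono) (auto simp: tight_def)
    then show "card (tight z) < Suc N" by simp
  qed
  ultimately obtain z where z: "good z" "\<And>z'. good z' \<Longrightarrow> card (tight z') \<le> card (tight z)"
    using ex_has_greatest_nat[of good _ "\<lambda>z. card (tight z)"] by blast
  have "N \<le> card (tight z) + card S"
  proof (rule ccontr)
    assume less: "\<not> ?thesis"
    define S' where "S' = S \<union> (\<lambda>i j. of_bool (i = j)) ` tight z"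
    have "card S' \<le> card S + card (tight z)"
      unfolding S'_def by (meson card_Un_le card_image_le fin add_left_mono order.trans)
    moreover have "finite S'" using S fin by (simp add: S'_def)
    then obtain P where P: "orth_proj N P" "\<forall>y\<in>S'. kills N P y"
      "real N - real (card S') \<le> (\<Sum>k<N. P k k)"
      using orth_proj_exists by blast
    ultimately have "0 < (\<Sum>k<N. P k k)" using less by linarith
    then have "(\<Sum>k<N. P k k) \<noteq> 0" by simp
    then obtain k where k: "k < N" "P k k \<noteq> 0" by (blast elim: sum.not_neutral_contains_not_neutral)
    \<comment> \<open>A nonzero row of the projection is orthogonal to everything that the projection kills.\<close>
    define h where "h = P k"
    have hS: "(\<Sum>l<N. h l * y l) = 0" if "y \<in> S'" for y
      using P(2) that k by (simp add: kills_def mat_app_def h_def)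
    have ht: "h i = 0" if "i \<in> tight z" for i
      using hS[of "\<lambda>j. of_bool (i = j)"] that
      by (auto simp: S'_def tight_def of_bool_def if_distrib cong: if_cong)
    define T where "T = {i. i < N \<and> h i \<noteq> 0}"
    have T: "finite T" "k \<in> T" using k by (auto simp: T_def h_def)
    have strict: "\<bar>z i\<bar> < 1" if "i \<in> T" for i
      using that z(1) ht[of i] by (auto simp: T_def good_def tight_def less_le)
    \<comment> \<open>The time at which coordinate \<open>i\<close> of \<open>z + t h\<close> reaches the face that \<open>h\<close> points to.\<close>
    define \<tau> where "\<tau> i = (1 - sgn (h i) * z i) / \<bar>h i\<bar>" for i
    define t where "t = Min (\<tau> ` T)"
    have "t \<in> \<tau> ` T" unfolding t_def using T by (intro Min_in) auto
    then obtain i0 where i0: "i0 \<in> T" "t = \<tau> i0" by blast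
    have sz: "\<bar>sgn (h i) * z i\<bar> < 1" if "i \<in> T" for i
      using strict[OF that] that by (simp add: abs_mult abs_sgn_eq T_def)
    have t: "0 < t" using sz[OF i0(1)] i0 by (auto simp: \<tau>_def T_def)
    define z' where "z' i = z i + t * h i" for i
    have sz': "sgn (h i) * z' i = sgn (h i) * z i + t * \<bar>h i\<bar>" for i
      by (simp add: z'_def distrib_left abs_sgn mult_ac)
    have abs_z': "\<bar>z' i\<bar> = \<bar>sgn (h i) * z' i\<bar>" if "i \<in> T" for i
      using that by (simp add: abs_mult abs_sgn_eq T_def)
    have "good z'"
      unfolding good_def
    proof (intro conjI allI impI ballI)
      fix i assume i: "i < N"
      show "\<bar>z' i\<bar> \<le> 1"
      proof (cases "i \<in> T")
        case True
        have "t \<le> \<tau> i" unfolding t_def using T True by (intro Min_le) auto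
        then have "t * \<bar>h i\<bar> \<le> 1 - sgn (h i) * z i"
          using True by (simp add: \<tau>_def T_def pos_le_divide_eq)
        moreover have "0 \<le> t * \<bar>h i\<bar>" using t by simp
        ultimately show ?thesis using sz[OF True] unfolding abs_z'[OF True] sz' by linarith
      next
        case False
        then show ?thesis using z(1) i by (simp add: z'_def T_def good_def)
      qed
    next
      fix y assume "y \<in> S"
      then show "(\<Sum>k<N. z' k * y k) = 0"
        using z(1) hS[of y]
        by (simp add: z'_def good_def distrib_right sum.distrib mult.assoc sum_distrib_left[symmetric] S'_def)
    qed
    moreover have "insert i0 (tight z) \<subseteq> tight z'"
    proof -
      have "\<bar>z' i0\<bar> = 1"
        unfolding abs_z'[OF i0(1)] sz' using i0 by (simp add: \<tau>_def T_def)
      then show ?thesis using i0 ht by (auto simp: tight_def z'_def T_def)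
    qed
    moreover have "i0 \<notin> tight z" using strict[OF i0(1)] by (auto simp: tight_def)
    ultimately show False
      using z(2)[of z'] card_mono[OF fin, of "insert i0 (tight z)" z'] fin by simp
  qed
  then show ?thesis using z(1) by (auto simp: good_def tight_def)
qed

text \<open>
  The vertex \<open>z\<close> of the section orthogonal to \<open>S\<close> is a dual certificate: testing against \<open>z\<close>
  annihilates the span, and the sign vector that agrees with \<open>z\<close> collects \<open>1\<close> from each coordinate of
  modulus one.
\<close>

lemma sign_vector_far_from_span:
  assumes "finite S"
  shows "\<exists>A. \<forall>y\<in>span S. real N - real (card S) \<le> (\<Sum>k<N. \<bar>flip A k - y k\<bar>)"
proof -
  obtain z :: "nat \<Rightarrow> real" where z: "\<forall>k<N. \<bar>z k\<bar> \<le> 1" "\<forall>y\<in>S. (\<Sum>k<N. z k * y k) = 0"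
    "N \<le> card {k. k < N \<and> \<bar>z k\<bar> = 1} + card S"
    using cube_section_vertex[OF assms] by blast
  define A where "A = {k. z k < 0}"
  have "real N - real (card S) \<le> (\<Sum>k<N. \<bar>flip A k - y k\<bar>)" if y: "y \<in> span S" for y
  proof -
    have "real N - real (card S) \<le> real (card {k. k < N \<and> \<bar>z k\<bar> = 1})" using z(3) by linarith
    also have "\<dots> = (\<Sum>k | k < N \<and> \<bar>z k\<bar> = 1. \<bar>z k\<bar>)" by simp
    also have "\<dots> \<le> (\<Sum>k<N. \<bar>z k\<bar>)" by (intro sum_mono2) auto
    also have "\<dots> = (\<Sum>k<N. z k * flip A k) - (\<Sum>k<N. z k * y k)"
      unfolding orthogonal_span[OF z(2) y] by (simp, intro sum.cong) (auto simp: A_def flip_def)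
    also have "\<dots> = (\<Sum>k<N. z k * (flip A k - y k))"
      by (simp add: right_diff_distrib sum_subtractf)
    also have "\<dots> \<le> (\<Sum>k<N. \<bar>flip A k - y k\<bar>)"
    proof (rule sum_mono)
      fix k assume "k \<in> {..<N}"
      then have "\<bar>z k\<bar> * \<bar>flip A k - y k\<bar> \<le> 1 * \<bar>flip A k - y k\<bar>"
        using z(1) by (intro mult_right_mono) auto
      then show "z k * (flip A k - y k) \<le> \<bar>flip A k - y k\<bar>"
        using abs_ge_self[of "z k * (flip A k - y k)"] by (simp add: abs_mult)
    qed
    finally show ?thesis .
  qed
  then show ?thesis by blast
qed

section \<open>Widths of the mixed ball\<close>

text \<open>
  Averaging does not change \<open>l\<^sub>1\<close> norms of nonnegative vectors, so \<open>y\<close> and \<open>z\<close> may be replaced by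
  constant vectors.  Their tensor product is constant, hence the mixed ball contains
  \<open>a\<close> times every sign vector, with \<open>a\<close> chosen so that its \<open>l\<^sub>1\<close> norm is the product of those of
  \<open>y\<close> and \<open>z\<close>.
\<close>

lemma mixed_ball_far_point_l1:
  assumes \<Phi>: "symmetric_norm s \<Phi>" and \<Psi>: "symmetric_norm b \<Psi>" and s: "0 < s" and b: "0 < b"
    and S: "finite S"
    and y: "y \<in> unit_ball (coord_space s) \<Phi>" and z: "z \<in> unit_ball (coord_space b) \<Psi>"
  shows "\<exists>x\<in>unit_ball (coord_space (s * b)) (mixed_norm s b \<Phi> \<Psi>). \<forall>v\<in>span S.
           (1 - real (card S) / real (s * b)) * (lq_norm 1 s y * lq_norm 1 b z) \<le> lq_norm 1 (s * b) (x - v)"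
proof -
  define N where "N = s * b"
  have N: "0 < N" using s b by (simp add: N_def)
  have l1: "lq_norm 1 m x = (\<Sum>k<m. \<bar>x k\<bar>)" for m x
    by (simp add: lq_norm_def sum_nonneg)
  define y' where "y' = (\<lambda>i. if i < s then (\<Sum>k<s. \<bar>y k\<bar>) / s else 0)"
  define z' where "z' = (\<lambda>i. if i < b then (\<Sum>k<b. \<bar>z k\<bar>) / b else 0)"
  have y': "y' \<in> unit_ball (coord_space s) \<Phi>"
    using y symmetric_norm_mean_le[OF \<Phi>, of y] by (auto simp: unit_ball_def y'_def coord_space_def)
  have z': "z' \<in> unit_ball (coord_space b) \<Psi>"
    using z symmetric_norm_mean_le[OF \<Psi>, of z] by (auto simp: unit_ball_def z'_def coord_space_def)
  define w where "w = (\<lambda>k. y' (k mod s) * z' (k div s))"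
  define a where "a = lq_norm 1 s y * lq_norm 1 b z / N"
  have a0: "0 \<le> a" by (simp add: a_def lq_norm_nonneg)
  have w: "w k = a" if "k < N" for k
    using that s div_less_block[of k s b] by (simp add: w_def y'_def z'_def a_def l1 N_def)
  obtain A where A: "\<And>v. v \<in> span S \<Longrightarrow> real N - real (card S) \<le> (\<Sum>k<N. \<bar>flip A k - v k\<bar>)"
    using sign_vector_far_from_span[OF S] by metis
  define x where "x = signed_shift s b A 0 w"
  have x: "x \<in> unit_ball (coord_space (s * b)) (mixed_norm s b \<Phi> \<Psi>)"
    unfolding x_def w_def using N
    by (intro signed_shift_in_mixed_ball tensor_in_mixed_ball \<Phi> \<Psi> s y' z') (simp add: N_def)
  have xk: "x k = a * flip A k" if "k < N" for k
    using bij_betwE[OF block_shift_bij[of k s b]] that N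
    by (simp add: x_def signed_shift_def w N_def)
  have "(1 - real (card S) / real N) * (lq_norm 1 s y * lq_norm 1 b z) \<le> lq_norm 1 N (x - v)"
    if v: "v \<in> span S" for v
  proof (cases "a = 0")
    case True
    then have "lq_norm 1 s y * lq_norm 1 b z = 0" using N unfolding a_def by simp
    then show ?thesis by (simp only: mult_zero_right lq_norm_nonneg)
  next
    case False
    then have a: "0 < a" using a0 by simp
    have "(1 - real (card S) / real N) * (lq_norm 1 s y * lq_norm 1 b z) = a * (real N - real (card S))"
      using N by (simp add: a_def field_simps)
    also have "\<dots> \<le> a * (\<Sum>k<N. \<bar>flip A k - ((1 / a) *\<^sub>R v) k\<bar>)"
      using a by (intro mult_left_mono A span_scale v) auto
    also have "\<dots> = (\<Sum>k<N. \<bar>a * (flip A k - ((1 / a) *\<^sub>R v) k)\<bar>)"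
      using a by (simp add: sum_distrib_left abs_mult)
    also have "\<dots> = lq_norm 1 N (x - v)"
      unfolding l1 using a by (intro sum.cong refl) (simp add: xk scaleR_fun_def right_diff_distrib)
    finally show ?thesis .
  qed
  then show ?thesis using x by (auto simp: N_def)
qed

lemma mixed_ball_far_point:
  fixes q \<epsilon> :: real
  assumes q: "1 \<le> q" "q \<le> 2" and \<epsilon>: "0 < \<epsilon>"
  shows "\<exists>c>0. \<forall>s b \<Phi> \<Psi> S y z. 0 < s \<longrightarrow> 0 < b \<longrightarrow> symmetric_norm s \<Phi> \<longrightarrow> symmetric_norm b \<Psi> \<longrightarrow>
           finite S \<longrightarrow> real (card S) \<le> real (s * b) * (1 - \<epsilon>) \<longrightarrow>
           y \<in> unit_ball (coord_space s) \<Phi> \<longrightarrow> z \<in> unit_ball (coord_space b) \<Psi> \<longrightarrow>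
           (\<exists>x\<in>unit_ball (coord_space (s * b)) (mixed_norm s b \<Phi> \<Psi>). \<forall>v\<in>span S.
              c * (lq_norm q s y * lq_norm q b z) \<le> lq_norm q (s * b) (x - v))"
proof (cases "q = 1")
  case True
  have "\<exists>x\<in>unit_ball (coord_space (s * b)) (mixed_norm s b \<Phi> \<Psi>). \<forall>v\<in>span S.
          \<epsilon> * (lq_norm q s y * lq_norm q b z) \<le> lq_norm q (s * b) (x - v)"
    if sb: "0 < s" "0 < b" and norms: "symmetric_norm s \<Phi>" "symmetric_norm b \<Psi>"
      and S: "finite S" "real (card S) \<le> real (s * b) * (1 - \<epsilon>)"
      and yz: "y \<in> unit_ball (coord_space s) \<Phi>" "z \<in> unit_ball (coord_space b) \<Psi>"
    for s b \<Phi> \<Psi> and S :: "(nat \<Rightarrow> real) set" and y z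
  proof -
    have N: "0 < real (s * b)" using sb by simp
    have "\<epsilon> \<le> 1 - real (card S) / real (s * b)"
    proof -
      have "real (card S) / real (s * b) \<le> 1 - \<epsilon>"
        using S(2) N by (subst pos_divide_le_eq) (auto simp: mult.commute)
      then show ?thesis by simp
    qed
    then have "\<epsilon> * (lq_norm 1 s y * lq_norm 1 b z)
        \<le> (1 - real (card S) / real (s * b)) * (lq_norm 1 s y * lq_norm 1 b z)"
      by (intro mult_right_mono mult_nonneg_nonneg lq_norm_nonneg)
    then show ?thesis
      using mixed_ball_far_point_l1[OF norms sb S(1) yz] unfolding True by (meson order.trans)
  qed
  then show ?thesis using \<epsilon> by blast
next
  case False
  then have q1: "1 < q" using q by simp
  obtain c where c: "0 < c" "\<And>s b P w. 0 < s * b \<Longrightarrow> orth_proj (s * b) P \<Longrightarrow>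
      \<epsilon> * real (s * b) \<le> (\<Sum>k<s * b. P k k) \<Longrightarrow>
      (\<exists>A. \<exists>t<s * b. \<forall>y. kills (s * b) P y \<longrightarrow>
         c * lq_norm q (s * b) w \<le> lq_norm q (s * b) (signed_shift s b A t w - y))"
    using orbit_far_from_kernel[OF q1 q(2) \<epsilon>] by blast
  have "\<exists>x\<in>unit_ball (coord_space (s * b)) (mixed_norm s b \<Phi> \<Psi>). \<forall>v\<in>span S.
          c * (lq_norm q s y * lq_norm q b z) \<le> lq_norm q (s * b) (x - v)"
    if sb: "0 < s" "0 < b" and norms: "symmetric_norm s \<Phi>" "symmetric_norm b \<Psi>"
      and S: "finite S" "real (card S) \<le> real (s * b) * (1 - \<epsilon>)"
      and yz: "y \<in> unit_ball (coord_space s) \<Phi>" "z \<in> unit_ball (coord_space b) \<Psi>"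
    for s b \<Phi> \<Psi> and S :: "(nat \<Rightarrow> real) set" and y z
  proof -
    define w where "w = (\<lambda>k. y (k mod s) * z (k div s))"
    obtain P where P: "orth_proj (s * b) P" "\<forall>v\<in>S. kills (s * b) P v"
      "real (s * b) - real (card S) \<le> (\<Sum>k<s * b. P k k)"
      using orth_proj_exists[OF S(1)] by blast
    have "\<epsilon> * real (s * b) \<le> (\<Sum>k<s * b. P k k)"
      using P(3) S(2) by (simp only: right_diff_distrib mult_1_right mult.commute[of \<epsilon>])
    then obtain A t where At: "t < s * b" "\<And>v. kills (s * b) P v \<Longrightarrow>
        c * lq_norm q (s * b) w \<le> lq_norm q (s * b) (signed_shift s b A t w - v)"
      using c(2)[of s b P w] P(1) sb by auto
    have "signed_shift s b A t w \<in> unit_ball (coord_space (s * b)) (mixed_norm s b \<Phi> \<Psi>)"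
      unfolding w_def by (intro signed_shift_in_mixed_ball tensor_in_mixed_ball norms sb(1) At(1) yz)
    moreover have "lq_norm q (s * b) w = lq_norm q s y * lq_norm q b z"
      unfolding w_def using q1 sb by (intro lq_norm_tensor) auto
    ultimately show ?thesis using At(2) kills_span[OF P(2)] by metis
  qed
  then show ?thesis using c(1) by blast
qed

lemma finite_dim_subspace_basis:
  fixes Q :: "'a::real_vector set"
  assumes "subspace Q" "\<exists>S. finite S \<and> Q = span S"
  obtains S where "finite S" "Q = span S" "card S = dim Q"
proof -
  obtain B where B: "B \<subseteq> Q" "independent B" "Q \<subseteq> span B" "card B = dim Q"
    by (rule basis_exists)
  moreover have "finite B"
    using assms(2) B(1,2) independent_span_bound by blast
  moreover have "span B = Q"
    using B assms(1) by (simp add: span_minimal subset_antisym)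
  ultimately show ?thesis using that by blast
qed

theorem mainTheorem4:
  fixes q \<epsilon> :: real
  assumes "1 \<le> q" "q \<le> 2" "0 < \<epsilon>" "\<epsilon> < 1"
  shows "\<exists>c::real. c > 0 \<and>
    (\<forall>s b N :: nat. \<forall>\<Phi> \<Psi> :: (nat \<Rightarrow> real) \<Rightarrow> real. \<forall>B :: (nat \<Rightarrow> real) set.
       s \<ge> 1 \<longrightarrow> b \<ge> 1 \<longrightarrow> N = s * b \<longrightarrow>
       symmetric_norm s \<Phi> \<longrightarrow> symmetric_norm b \<Psi> \<longrightarrow>
       B = unit_ball (coord_space N) (mixed_norm s b \<Phi> \<Psi>) \<longrightarrow>
       (\<forall>n::nat. real n \<le> real N * (1 - \<epsilon>) \<longrightarrow>
          kolmogorov_width n B (coord_space N) (lq_norm q N)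
            \<ge> ereal c * (SUP x\<in>B. ereal (lq_norm q N x)) \<and>
          ereal c * (SUP x\<in>B. ereal (lq_norm q N x))
            = ereal c * (SUP y\<in>unit_ball (coord_space s) \<Phi>. ereal (lq_norm q s y))
                * (SUP z\<in>unit_ball (coord_space b) \<Psi>. ereal (lq_norm q b z))))"
proof -
  obtain c where c: "0 < c" "\<And>s b \<Phi> \<Psi> S y z. 0 < s \<Longrightarrow> 0 < b \<Longrightarrow> symmetric_norm s \<Phi> \<Longrightarrow>
      symmetric_norm b \<Psi> \<Longrightarrow> finite S \<Longrightarrow> real (card S) \<le> real (s * b) * (1 - \<epsilon>) \<Longrightarrow>
      y \<in> unit_ball (coord_space s) \<Phi> \<Longrightarrow> z \<in> unit_ball (coord_space b) \<Psi> \<Longrightarrow>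
      \<exists>x\<in>unit_ball (coord_space (s * b)) (mixed_norm s b \<Phi> \<Psi>). \<forall>v\<in>span S.
        c * (lq_norm q s y * lq_norm q b z) \<le> lq_norm q (s * b) (x - v)"
    using mixed_ball_far_point[OF assms(1,2,3)] by blast
  have width: "ereal c * (SUP x\<in>B. ereal (lq_norm q N x)) \<le> kolmogorov_width n B (coord_space N) (lq_norm q N)"
    if sb: "0 < s" "0 < b" and N: "N = s * b" and norms: "symmetric_norm s \<Phi>" "symmetric_norm b \<Psi>"
      and B: "B = unit_ball (coord_space N) (mixed_norm s b \<Phi> \<Psi>)" and n: "real n \<le> real N * (1 - \<epsilon>)"
    for s b N n \<Phi> \<Psi> B
    unfolding kolmogorov_width_def
  proof (rule INF_greatest)
    fix Q assume "Q \<in> {Q. subspace Q \<and> Q \<subseteq> coord_space N \<and> (\<exists>S. finite S \<and> Q = span S) \<and> dim Q \<le> n}"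
    then have Q: "subspace Q" "\<exists>S. finite S \<and> Q = span S" "dim Q \<le> n" by auto
    then obtain S where S: "finite S" "Q = span S" "card S = dim Q"
      by (elim finite_dim_subspace_basis)
    have card: "real (card S) \<le> real (s * b) * (1 - \<epsilon>)"
      using S(3) Q(3) n by (simp add: N)
    have far: "ereal (c * lq_norm q N u) \<le> (SUP x\<in>B. INF v\<in>Q. ereal (lq_norm q N (x - v)))"
      if u: "u \<in> B" for u
    proof -
      have "mixed_norm s b \<Phi> \<Psi> u \<le> 1" using u by (simp add: B unit_ball_def)
      then obtain y z where yz: "y \<in> unit_ball (coord_space s) \<Phi>" "z \<in> unit_ball (coord_space b) \<Psi>"
        "lq_norm q N u \<le> lq_norm q s y * lq_norm q b z"
        using lq_norm_le_tensor[OF norms(1) _ sb, of q \<Psi> u] assms(1) unfolding N by auto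
      obtain x where x: "x \<in> B" "\<And>v. v \<in> Q \<Longrightarrow> c * (lq_norm q s y * lq_norm q b z) \<le> lq_norm q N (x - v)"
        using c(2)[OF sb norms S(1) card yz(1,2)] unfolding B N S(2) by blast
      have "c * lq_norm q N u \<le> c * (lq_norm q s y * lq_norm q b z)"
        using c(1) yz(3) by (intro mult_left_mono) auto
      then have "ereal (c * lq_norm q N u) \<le> (INF v\<in>Q. ereal (lq_norm q N (x - v)))"
        using x(2) by (intro INF_greatest) (simp add: order.trans)
      then show ?thesis by (rule SUP_upper2[OF x(1)])
    qed
    have "(\<lambda>_. 0) \<in> B"
    proof -
      have "block s (\<lambda>_. 0) j = (\<lambda>_. 0)" for j by (simp add: block_def fun_eq_iff)
      then show ?thesis
        using symmetric_norm_0[OF norms(1)] symmetric_norm_0[OF norms(2)]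
        by (simp add: B unit_ball_def coord_space_def mixed_norm_def cong: if_cong)
    qed
    then have "ereal c * (SUP x\<in>B. ereal (lq_norm q N x)) = (SUP x\<in>B. ereal c * ereal (lq_norm q N x))"
      using c(1) by (intro Sup_ereal_mult_left') auto
    also have "\<dots> \<le> (SUP x\<in>B. INF v\<in>Q. ereal (lq_norm q N (x - v)))"
      using far by (intro SUP_least) simp
    finally show "ereal c * (SUP x\<in>B. ereal (lq_norm q N x))
        \<le> (SUP x\<in>B. INF v\<in>Q. ereal (lq_norm q N (x - v)))" .
  qed
  show ?thesis
  proof (intro exI[of _ c] conjI allI impI)
    fix s b N n :: nat and \<Phi> \<Psi> :: "(nat \<Rightarrow> real) \<Rightarrow> real" and B :: "(nat \<Rightarrow> real) set"
    assume sb: "1 \<le> s" "1 \<le> b" and N: "N = s * b" and norms: "symmetric_norm s \<Phi>" "symmetric_norm b \<Psi>"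
      and B: "B = unit_ball (coord_space N) (mixed_norm s b \<Phi> \<Psi>)" and n: "real n \<le> real N * (1 - \<epsilon>)"
    show "ereal c * (SUP x\<in>B. ereal (lq_norm q N x)) \<le> kolmogorov_width n B (coord_space N) (lq_norm q N)"
      using sb by (intro width[OF _ _ N norms B n]) auto
    show "ereal c * (SUP x\<in>B. ereal (lq_norm q N x))
            = ereal c * (SUP y\<in>unit_ball (coord_space s) \<Phi>. ereal (lq_norm q s y))
                * (SUP z\<in>unit_ball (coord_space b) \<Psi>. ereal (lq_norm q b z))"
      using sb assms(1) SUP_lq_norm_mixed_ball[OF norms, of q] by (simp add: B N mult.assoc)
  qed (rule c(1))
qed

end
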